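(* Let $\mathbf{A}\subset L$ be the set of all points whose $T$-orbit is not periodic. Then $\mathbf{A}\cap T(\mathcal{Z})$ is a proper dense subset of the attractor $Y'$, and the set of addresses of the points of $\mathbf{A}\cap T(\mathcal{Z})$, that is, the set of all infinite words $(m_i)_{i\ge 1}\in\{0,2,3,5\}^{\mathbb{N}}$ which are addresses of some point of $\mathbf{A}\cap T(\mathcal{Z})$, is recognized by a Büchi automaton over the alphabet $\{0,2,3,5\}$.
   Context: Let $\zeta=\exp(2\pi i/5)$ and $\omega=\frac{1+\sqrt5}{2}$. Let $L=[0,1)+(-\zeta^{-1})[0,1)=\{s-t\zeta^{-1}: s,t\in[0,1)\}\subset\mathbb{C}$, and put $\Delta=\{x\in L:\operatorname{Im}(x/\zeta)\ge 0\}$, $\mathcal{Z}=L\setminus\Delta$. The map $T:L\to L$ is the bijective piecewise isometry $T(x)=x/\zeta$ for $x\in\Delta$ and $T(x)=(x-1)/\zeta$ for $x\in\mathcal{Z}$. Put $d_0=0$, $d_2=\zeta$, $d_3=\zeta/\omega$, $d_5=-\frac{1}{\omega\zeta}$. The attractor $Y'$ is the unique non-empty compact subset of $\mathbb{C}$ satisfying $Y'=\bigcup_{m\in\{0,2,3,5\}}\left(\frac{\zeta^m}{\omega^2}Y'+d_m\right)$. An address of a point $x\in Y'$ is a sequence $(m_i)_{i\ge1}\in\{0,2,3,5\}^{\mathbb{N}}$ (equivalently the word $d_{m_1}d_{m_2}\cdots$) with $$x=d_{m_1}+\frac{\zeta^{m_1}}{\omega^2}\left(d_{m_2}+\frac{\zeta^{m_2}}{\omega^2}\left(d_{m_3}+\frac{\zeta^{m_3}}{\omega^2}\left(\cdots\right)\right)\right).$$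 Every point of $Y'$ has at least one address. A Büchi automaton is a finite (possibly nondeterministic) automaton with edges labelled by the alphabet, initial states and final states; it accepts an infinite word if some infinite run from an initial state labelled by that word visits final states infinitely often. *)

theory Defs
  imports "HOL-Analysis.Analysis"
begin

definition zeta :: complex where
  "zeta = exp (2 * of_real pi * \<i> / 5)"

definition omega :: real where
  "omega = (1 + sqrt 5) / 2"

definition L_set :: "complex set" where
  "L_set = {of_real s - of_real t * inverse zeta | s t :: real.
              s \<in> {0..<1} \<and> t \<in> {0..<1}}"

definition Delta_set :: "complex set" where
  "Delta_set = {x \<in> L_set. Im (x / zeta) \<ge> 0}"

definition Z_set :: "complex set" where
  "Z_set = L_set - Delta_set"

text \<open>The map is only meaningful on \<^term>\<open>L_set\<close>; values outside are irrelevant.\<close>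

definition T_map :: "complex \<Rightarrow> complex" where
  "T_map x = (if x \<in> Delta_set then x / zeta else (x - 1) / zeta)"

definition periodic_orbit :: "complex \<Rightarrow> bool" where
  "periodic_orbit x \<longleftrightarrow> (\<exists>p>0. \<forall>n. (T_map ^^ (n + p)) x = (T_map ^^ n) x)"

definition aperiodic_points :: "complex set" where
  "aperiodic_points = {x \<in> L_set. \<not> periodic_orbit x}"

definition digits :: "nat set" where
  "digits = {0, 2, 3, 5}"

text \<open>The value at indices outside \<^term>\<open>digits\<close> is irrelevant.\<close>

definition d_shift :: "nat \<Rightarrow> complex" where
  "d_shift m = (if m = 2 then zeta
          else if m = 3 then zeta / of_real omega
          else if m = 5 then - (1 / (of_real omega * zeta))
          else 0)"

definition contr :: "nat \<Rightarrow> complex \<Rightarrow> complex" where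
  "contr m x = zeta ^ m / of_real (omega ^ 2) * x + d_shift m"

definition attractor :: "complex set" where
  "attractor = (THE Y. compact Y \<and> Y \<noteq> {} \<and> Y = (\<Union>m\<in>digits. contr m ` Y))"

text \<open>
  Words are indexed from \<open>0\<close>. The infinitely nested expression defining an address
  is read as the limit of its truncations, the innermost bracket being replaced by \<open>0\<close>.
\<close>

primrec nested :: "(nat \<Rightarrow> nat) \<Rightarrow> nat \<Rightarrow> complex" where
  "nested w 0 = 0"
| "nested w (Suc n) =
     d_shift (w 0) + zeta ^ (w 0) / of_real (omega ^ 2) * nested (\<lambda>i. w (Suc i)) n"

definition is_address :: "(nat \<Rightarrow> nat) \<Rightarrow> complex \<Rightarrow> bool" where
  "is_address w x \<longleftrightarrow> (\<forall>i. w i \<in> digits) \<and> nested w \<longlonglongrightarrow> x"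

record ('q, 'a) buchi =
  states :: "'q set"
  alphabet :: "'a set"
  initials :: "'q set"
  finals :: "'q set"
  edges :: "('q \<times> 'a \<times> 'q) set"

definition buchi_automaton :: "('q, 'a) buchi \<Rightarrow> bool" where
  "buchi_automaton A \<longleftrightarrow>
     finite (states A) \<and> finite (alphabet A) \<and>
     initials A \<subseteq> states A \<and> finals A \<subseteq> states A \<and>
     edges A \<subseteq> states A \<times> alphabet A \<times> states A"

definition is_run :: "('q, 'a) buchi \<Rightarrow> (nat \<Rightarrow> 'a) \<Rightarrow> (nat \<Rightarrow> 'q) \<Rightarrow> bool" where
  "is_run A w r \<longleftrightarrow> r 0 \<in> initials A \<and> (\<forall>i. (r i, w i, r (Suc i)) \<in> edges A)"

definition buchi_language :: "('q, 'a) buchi \<Rightarrow> (nat \<Rightarrow> 'a) set" where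
  "buchi_language A = {w. \<exists>r. is_run A w r \<and> (\<exists>\<^sub>\<infinity>i. r i \<in> finals A)}"

text \<open>State sets are finite, so taking the states to be natural numbers is no restriction.\<close>

definition buchi_recognizable :: "'a set \<Rightarrow> (nat \<Rightarrow> 'a) set \<Rightarrow> bool" where
  "buchi_recognizable \<Sigma> W \<longleftrightarrow>
     (\<exists>A :: (nat, 'a) buchi. buchi_automaton A \<and> alphabet A = \<Sigma> \<and> buchi_language A = W)"

end

theory Submission
  imports Defs
begin

text \<open>
  Writing \<open>x = s - t / zeta\<close> turns \<open>L\<close> into the unit square and \<open>T\<close> into
  \<open>(s, t) \<mapsto> (t, frac (lam * t - s))\<close> with \<open>lam = 1 / omega\<close>; the image \<open>T(Z)\<close> becomes
  \<open>TZ_coord\<close>, a trapezium that contains its long base and none of its other sides.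
  The reason for all claims is that the first return map \<open>S\<close> of \<open>T\<close> to \<open>TZ_coord\<close> renormalises.
  On \<open>TZ_coord\<close> the four contractions \<open>F m\<close> defining the attractor satisfy
  \<open>S F5 = F3\<close>, \<open>S F3 = F2\<close>, \<open>S F2 = F0\<close> and \<open>S F0 = F5 S\<close> (\<open>ret_map_contr_coord\<close>): the four small
  trapezia form a tower over \<open>F0\<close>, through which \<open>S\<close> runs while it does one step at the large scale.
  So the orbit of \<open>F m y\<close> is finite exactly if that of \<open>y\<close> is, and it is then strictly longer.
  What the four trapezia do not cover in \<open>TZ_coord\<close> lies in two pentagons that \<open>S\<close> rotates
  (\<open>TZ_coord_cover\<close>), hence is periodic.

  Therefore the set \<open>A\<close> of aperiodic points of \<open>TZ_coord\<close> is the union of its images \<open>F m A\<close>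
  (\<open>aper_coord_eq\<close>), so each of its points has an address all of whose tails have their value in \<open>A\<close>.
  Conversely, a point having an address all of whose tails have their value in \<open>TZ_coord\<close> is aperiodic, since
  orbit lengths would decrease along the tails (\<open>infinite_orb_of_depth\<close>). The value of every word lies
  in the closed trapezium and never on the short base, so only the two legs have to be avoided.
  The words whose value lies on a leg form a subshift given by allowed pairs of consecutive letters
  (\<open>leg_pair\<close>), and a tail of a word of this subshift is again one. Hence \<open>A\<close> is the set of values
  of words with infinitely many pairs that are not allowed (\<open>pt_aper_coord_val\<close>). Density is then
  immediate, and the vertex \<open>0\<close>, with address \<open>000...\<close>, is in the attractor but not in \<open>A\<close>.

  For the automaton, a word \<open>w\<close> is an address of a point of \<open>A\<close> if and only if some such word \<open>v\<close> has
  the same value. The automaton guesses \<open>v\<close> letter by letter and records the similarity that takes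
  the value of the remaining tail of \<open>w\<close> to that of \<open>v\<close>. It is an isometry \<open>y \<mapsto> zeta^j * y + b\<close> with \<open>b\<close> in
  \<open>\<int>[zeta]\<close>; \<open>b\<close> is bounded because values are, and its Galois conjugate is bounded because the
  expansion by \<open>omega^2\<close> conjugates to a contraction. Only finitely many \<open>b\<close> satisfy both bounds
  (\<open>finite_lattice_bounded\<close>).
\<close>

section \<open>The ring of integers and coordinates on the rhombus\<close>

text \<open>
  The inverse of the golden ratio equals \<open>zeta + 1 / zeta\<close>; the relation \<open>lam * lam = 1 - lam\<close>
  reduces all computations to expressions that are linear in \<open>lam\<close>.
\<close>

definition lam :: real where "lam = (sqrt 5 - 1) / 2"

lemma lam_bounds: "lam > 3/5" "lam < 5/8"
proof -
  have "sqrt 5 > 11/5" by (rule real_less_rsqrt) (simp add: power2_eq_square)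
  then show "lam > 3/5" by (simp add: lam_def)
  have "sqrt 5 < 9/4" by (rule real_less_lsqrt) (simp_all add: power2_eq_square)
  then show "lam < 5/8" by (simp add: lam_def)
qed

lemma lam_sq: "lam * lam = 1 - lam"
  by (simp add: lam_def field_simps)

lemma lam_sq': "lam * (lam * x) = x - lam * x"
  using lam_sq by (metis left_diff_distrib mult.assoc mult_1)

lemmas lam_red = lam_sq lam_sq'

lemma omega_lam: "omega = 1 + lam"
  by (simp add: omega_def lam_def field_simps)

lemma omega_times_lam: "omega * lam = 1"
  by (simp add: omega_lam algebra_simps lam_red)

lemma inverse_omega_sq: "1 / omega ^ 2 = 1 - lam"
proof -
  have "omega ^ 2 * (1 - lam) = 1"
    by (simp add: omega_lam power2_eq_square algebra_simps lam_red)
  then show ?thesis by (metis nonzero_mult_div_cancel_left mult_zero_left zero_neq_one)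
qed

lemma zeta_cis: "zeta = cis (2 * pi / 5)"
  by (simp add: zeta_def cis_conv_exp mult.commute)

lemma zeta_pow5: "zeta ^ 5 = 1"
  using cis_2pi by (simp add: zeta_cis Complex.DeMoivre del: cis_2pi)

lemma norm_zeta [simp]: "norm zeta = 1"
  by (simp add: zeta_cis)

lemma zeta_nonzero [simp]: "zeta \<noteq> 0"
  by (metis norm_zeta norm_zero zero_neq_one)

lemma Im_zeta: "Im zeta > 1/2"
proof -
  have "sin (pi / 6) < sin (2 * pi / 5)"
    using pi_gt_zero by (intro sin_monotone_2pi) linarith+
  then show ?thesis by (simp add: zeta_cis sin_30)
qed

lemma Re_zeta_pos: "Re zeta > 0"
  unfolding zeta_cis cis.sel by (intro cos_gt_zero_pi; use pi_gt_zero in linarith)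

lemma inverse_zeta: "inverse zeta = cnj zeta"
  by (simp add: zeta_cis cis_cnj)

text \<open>
  The sum \<open>zeta + 1 / zeta\<close> is real and, since the fifth roots of unity add up to \<open>0\<close>, it is a root of
  \<open>X^2 + X - 1\<close>, whose only positive root is \<open>lam\<close>.
\<close>

lemma zeta_sum: "zeta + inverse zeta = of_real lam"
proof -
  define c where "c = 2 * Re zeta"
  have c: "zeta + inverse zeta = of_real c"
    by (simp add: inverse_zeta c_def complex_eq_iff)
  have "zeta \<noteq> 1" using Im_zeta by auto
  have "(zeta - 1) * (1 + zeta + zeta^2 + zeta^3 + zeta^4) = zeta ^ 5 - 1"
    by (simp add: algebra_simps eval_nat_numeral)
  with zeta_pow5 \<open>zeta \<noteq> 1\<close> have 0: "1 + zeta + zeta^2 + zeta^3 + zeta^4 = 0"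
    by simp
  have "(zeta + inverse zeta) ^ 2 + (zeta + inverse zeta) - 1
      = (1 + zeta + zeta^2 + zeta^3 + zeta^4) / zeta ^ 2"
    by (simp add: field_simps eval_nat_numeral)
  then have "complex_of_real (c^2 + c - 1) = 0"
    using 0 c by simp
  then have "c^2 + c - 1 = 0" by (simp only: of_real_eq_0_iff)
  then have "(c - lam) * (c + 1 + lam) = 0"
    by (simp add: algebra_simps lam_red power2_eq_square)
  moreover have "c > 0" using Re_zeta_pos by (simp add: c_def)
  ultimately have "c = lam" using lam_bounds by auto
  then show ?thesis using c by simp
qed

lemma zeta_via_inverse: "zeta = of_real lam - inverse zeta"
  using zeta_sum by (simp add: algebra_simps)

lemma inverse_zeta_sq: "inverse zeta * inverse zeta = of_real lam * inverse zeta - 1"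
proof -
  have "zeta * inverse zeta = 1" by simp
  then have "(of_real lam - inverse zeta) * inverse zeta = 1"
    by (subst (asm) zeta_via_inverse) simp
  then show ?thesis by (simp add: algebra_simps)
qed

text \<open>
  In these coordinates \<open>L\<close> is the half-open unit square.
\<close>

fun pt :: "real \<times> real \<Rightarrow> complex" where
  "pt (s, t) = of_real s - of_real t * inverse zeta"

lemma Im_inverse_zeta: "Im (inverse zeta) = - Im zeta"
  by (simp add: inverse_zeta)

lemma pt_eq_iff [simp]: "pt p = pt q \<longleftrightarrow> p = q"
proof (cases p, cases q)
  fix s t s' t' assume [simp]: "p = (s, t)" "q = (s', t')"
  show ?thesis
  proof
    assume eq: "pt p = pt q"
    then have "Im (pt p) = Im (pt q)" by simp
    then have "t = t'" using Im_zeta by (simp add: inverse_zeta)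
    moreover from this eq have "s = s'" by simp
    ultimately show "p = q" by simp
  qed simp
qed

lemma pt_div_zeta: "pt (s, t) / zeta = pt (t, lam * t - s)"
proof -
  have "pt (s, t) / zeta = of_real s * inverse zeta - of_real t * (inverse zeta * inverse zeta)"
    by (simp add: divide_inverse algebra_simps)
  then show ?thesis unfolding inverse_zeta_sq by (simp add: algebra_simps)
qed

lemma pt_times_zeta: "zeta * pt (s, t) = pt (lam * s - t, s)"
proof -
  have "zeta * pt (s, t) = of_real s * zeta - of_real t"
    by (simp add: algebra_simps)
  then show ?thesis by (subst (asm) zeta_via_inverse) (simp add: algebra_simps)
qed

lemma Im_pt: "Im (pt (s, t)) = t * Im zeta"
  by (simp add: inverse_zeta)

fun T_coord :: "real \<times> real \<Rightarrow> real \<times> real" where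
  "T_coord (s, t) = (t, if s \<le> lam * t then lam * t - s else 1 - s + lam * t)"

text \<open>
  The maps \<open>contr m\<close> in coordinates, with \<open>lam^2\<close> written as \<open>1 - lam\<close> and \<open>lam^3\<close> as \<open>2 * lam - 1\<close>.
  Indices other than the digits are treated like \<open>0\<close>.
\<close>

fun contr_coord :: "nat \<Rightarrow> real \<times> real \<Rightarrow> real \<times> real" where
  "contr_coord m (s, t) =
     (if m = 2 then (lam - (2 * lam - 1) * (s + t), 1 + (2 * lam - 1) * s - (1 - lam) * t)
      else if m = 3 then (1 - lam + (2 * lam - 1) * t - (1 - lam) * s, lam - (2 * lam - 1) * (s + t))
      else if m = 5 then ((1 - lam) * s, (1 - lam) * t + lam)
      else ((1 - lam) * s, (1 - lam) * t))"

definition unit_square :: "(real \<times> real) set" where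
  "unit_square = {0..<1} \<times> {0..<1}"

lemma L_set_pt: "L_set = pt ` unit_square"
proof -
  have "L_set = {pt (s, t) | s t. s \<in> {0..<1} \<and> t \<in> {0..<1}}"
    by (simp add: L_set_def)
  then show ?thesis unfolding unit_square_def by blast
qed

lemma pt_in_L [simp]: "pt p \<in> L_set \<longleftrightarrow> p \<in> unit_square"
  by (auto simp: L_set_pt image_iff)

lemma pt_in_Delta: "pt (s, t) \<in> Delta_set \<longleftrightarrow> (s, t) \<in> unit_square \<and> s \<le> lam * t"
proof -
  have "0 \<le> Im zeta" "Im zeta \<noteq> 0" using Im_zeta by auto
  then show ?thesis
    using Im_zeta by (simp add: Delta_set_def pt_div_zeta Im_pt zero_le_mult_iff del: pt.simps)
qed

lemma pt_minus_1: "pt (s, t) - 1 = pt (s - 1, t)"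
  by simp

lemma T_map_pt: "p \<in> unit_square \<Longrightarrow> T_map (pt p) = pt (T_coord p)"
  by (cases p) (simp add: T_map_def pt_in_Delta pt_minus_1 pt_div_zeta algebra_simps del: pt.simps)

lemma contr_pt:
  assumes "m \<in> digits"
  shows "contr m (pt p) = pt (contr_coord m p)"
proof (cases p)
  case [simp]: (Pair s t)
  have sc: "x / complex_of_real (omega ^ 2) = of_real (1 - lam) * x" for x
    using inverse_omega_sq by (metis divide_inverse_commute inverse_eq_divide of_real_inverse)
  have om: "1 / complex_of_real omega = of_real lam" "inverse (complex_of_real omega) = of_real lam"
    using omega_times_lam
    by (metis inverse_eq_divide inverse_unique of_real_inverse)+
  have c: "contr k x = of_real (1 - lam) * (zeta ^ k * x) + d_shift k" for k x
    using sc[of "zeta ^ k"] by (simp add: contr_def)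
  have r: "of_real a * pt (u, v) = pt (a * u, a * v)" for a u v
    by (simp add: algebra_simps)
  have add: "pt (a, b) + pt (u, v) = pt (a + u, b + v)" for a b u v
    by (simp add: algebra_simps)
  have d2: "d_shift 2 = pt (lam, 1)"
    using zeta_via_inverse by (simp add: d_shift_def)
  have d3: "d_shift 3 = pt (1 - lam, lam)"
  proof -
    have "d_shift 3 = of_real lam * zeta"
      using om by (simp add: d_shift_def divide_inverse)
    also have "\<dots> = of_real lam * pt (lam, 1)"
      using zeta_via_inverse by simp
    finally show ?thesis unfolding r by (simp add: lam_red del: pt.simps)
  qed
  have d5: "d_shift 5 = pt (0, lam)"
    using om by (simp add: d_shift_def divide_inverse)
  have d0: "d_shift 0 = pt (0, 0)"
    by (simp add: d_shift_def)
  have "m = 0 \<or> m = 2 \<or> m = 3 \<or> m = 5" using assms by (auto simp: digits_def)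
  then show ?thesis
    by (elim disjE)
      (simp_all add: c d2 d3 d5 d0 r add zeta_pow5 power2_eq_square power3_eq_cube mult.assoc pt_times_zeta
         algebra_simps lam_red del: pt.simps)
qed

section \<open>The first return map and its renormalisation\<close>

lemma lam_numeral: "lam * (numeral k * x) = numeral k * (lam * x)"
  by simp

lemmas lam_expand = ring_distribs mult.assoc lam_red lam_numeral mult_minus_left mult_minus_right mult_zero_right mult_1_left mult_1_right

lemma num_eqs: "(0::nat) \<noteq> 2" "(0::nat) \<noteq> 3" "(0::nat) \<noteq> 5" "(3::nat) \<noteq> 2" "(5::nat) \<noteq> 2" "(5::nat) \<noteq> 3"
  by auto

lemma lam_powers: "0 < lam" "0 < 1 - lam" "0 < 2 * lam - 1" "0 < 2 - 3 * lam"
  using lam_bounds by simp_all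

text \<open>
  Linear inequalities with coefficients in \<open>\<rat>(sqrt 5)\<close> become inequalities over \<open>\<rat>\<close> in the unknowns
  \<open>lam\<close>, \<open>s\<close>, \<open>lam * s\<close>, \<open>t\<close>, \<open>lam * t\<close>. To be able to deduce one from others by linear
  arithmetic, the hypotheses are supplied together with their multiples by powers of \<open>lam\<close>.
\<close>

lemma lam_less:
  assumes "a < (b::real)"
  shows "lam * a < lam * b" "(1 - lam) * a < (1 - lam) * b" "(2 * lam - 1) * a < (2 * lam - 1) * b"
    "(2 - 3 * lam) * a < (2 - 3 * lam) * b"
  using assms lam_powers by (simp_all add: mult_strict_left_mono)

lemma lam_le:
  assumes "a \<le> (b::real)"
  shows "lam * a \<le> lam * b" "(1 - lam) * a \<le> (1 - lam) * b" "(2 * lam - 1) * a \<le> (2 * lam - 1) * b"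
  using assms lam_powers by (simp_all add: mult_left_mono)

text \<open>
  The set \<open>T(Z)\<close> in coordinates. Of the boundary of this trapezium only the long base \<open>s = 0\<close>,
  without its end points, belongs to the set.
\<close>

definition TZ_coord :: "(real \<times> real) set" where
  "TZ_coord = {(s, t). 0 \<le> s \<and> s < 1 \<and> t < 1 \<and> lam * s < t}"

lemma TZ_coord_pos: "(s, t) \<in> TZ_coord \<Longrightarrow> 0 < t"
proof -
  assume "(s, t) \<in> TZ_coord"
  then have "0 \<le> s" "lam * s < t" by (auto simp: TZ_coord_def)
  moreover have "0 \<le> lam * s" using \<open>0 \<le> s\<close> lam_bounds by simp
  ultimately show ?thesis by linarith
qed

lemma TZ_coord_unit_square: "TZ_coord \<subseteq> unit_square"
  using TZ_coord_pos by (force simp: TZ_coord_def unit_square_def)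

lemma Z_set_pt: "Z_set = pt ` {(s, t) \<in> unit_square. lam * t < s}"
  by (auto simp: Z_set_def L_set_pt pt_in_Delta image_iff simp del: pt.simps)

lemma T_Z_pt: "T_map ` Z_set = pt ` TZ_coord"
proof -
  have "T_coord ` {(s, t) \<in> unit_square. lam * t < s} = TZ_coord"
  proof (intro equalityI subsetI)
    fix p assume "p \<in> T_coord ` {(s, t) \<in> unit_square. lam * t < s}"
    then obtain s t where st: "0 \<le> s" "s < 1" "0 \<le> t" "t < 1" "lam * t < s" "p = (t, 1 - s + lam * t)"
      by (auto simp: unit_square_def)
    then show "p \<in> TZ_coord" by (auto simp: TZ_coord_def)
  next
    fix p assume p: "p \<in> TZ_coord"
    obtain s t where pp[simp]: "p = (s, t)" by (cases p)
    have st: "0 \<le> s" "s < 1" "lam * s < t" "t < 1" using p by (auto simp: TZ_coord_def)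
    have "p = T_coord (1 - t + lam * s, s)" using st by simp
    moreover have "0 \<le> lam * s" using st lam_bounds by simp
    moreover have "lam * s < 1" using st by linarith
    moreover have "(1 - t + lam * s, s) \<in> {(s, t) \<in> unit_square. lam * t < s}"
      using st \<open>0 \<le> lam * s\<close> by (auto simp: unit_square_def)
    ultimately show "p \<in> T_coord ` {(s, t) \<in> unit_square. lam * t < s}"
      by blast
  qed
  moreover have "T_map ` Z_set = pt ` T_coord ` {(s, t) \<in> unit_square. lam * t < s}"
    unfolding Z_set_pt image_image by (rule image_cong) (auto simp: T_map_pt simp del: pt.simps T_coord.simps)
  ultimately show ?thesis by simp
qed

lemma T_coord_unit_square: "p \<in> unit_square \<Longrightarrow> T_coord p \<in> unit_square"
proof -
  assume p: "p \<in> unit_square"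
  obtain s t where pp[simp]: "p = (s, t)" by (cases p)
  have st: "0 \<le> s" "s < 1" "0 \<le> t" "t < 1" using p by (auto simp: unit_square_def)
  then have "0 \<le> lam * t" "lam * t < 1"
    using lam_le(1)[of 0 t] lam_less(1)[of t 1] lam_bounds by linarith+
  then show ?thesis using st by (auto simp: unit_square_def)
qed

lemma T_coord_inj: "inj_on T_coord unit_square"
proof (rule inj_onI)
  fix p q assume "p \<in> unit_square" "q \<in> unit_square" "T_coord p = T_coord q"
  then show "p = q"
    by (cases p; cases q) (auto simp: unit_square_def split: if_splits)
qed

text \<open>
  The first return map of \<open>T\<close> to \<open>TZ_coord\<close>. Where \<open>s \<le> lam * t\<close>, that is on \<open>\<Delta>\<close>, the point is
  outside \<open>TZ_coord\<close> for one step and returns with the next one.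
\<close>

fun ret_map :: "real \<times> real \<Rightarrow> real \<times> real" where
  "ret_map (s, t) = (if s \<le> lam * t then (lam * t - s, 1 - lam * s - lam * t) else (t, 1 - s + lam * t))"

lemma ret_map_TZ_coord:
  assumes "p \<in> TZ_coord"
  shows "ret_map p \<in> TZ_coord"
proof -
  obtain s t where pp: "p = (s, t)" by (cases p)
  have st: "0 \<le> s" "s < 1" "lam * s < t" "t < 1" "0 < t" using assms TZ_coord_pos by (auto simp: TZ_coord_def pp)
  show ?thesis
  proof (cases "s \<le> lam * t")
    case D: True
    then show ?thesis
      apply (simp only: pp ret_map.simps TZ_coord_def mem_Collect_eq prod.case if_True if_False refl num_eqs lam_expand)
      apply (intro conjI)
      subgoal using D by linarith
      subgoal using st(1) lam_less(1)[OF st(4), unfolded lam_expand] lam_powers(2) by linarith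
      subgoal using lam_le(1)[OF st(1), unfolded lam_expand] lam_less(1)[OF st(5), unfolded lam_expand] by linarith
      subgoal using st(4) by linarith
      done
  next
    case False
    then have Q: "lam * t < s" by simp
    from False show ?thesis
      apply (simp only: pp ret_map.simps TZ_coord_def mem_Collect_eq prod.case if_True if_False refl num_eqs lam_expand)
      apply (intro conjI)
      subgoal using st(5) by linarith
      subgoal using st(4) by linarith
      subgoal using Q by linarith
      subgoal using st(2) by linarith
      done
  qed
qed

lemma ret_map_T_coord:
  assumes "p \<in> TZ_coord"
  shows "ret_map p = T_coord p \<or> ret_map p = T_coord (T_coord p)"
proof -
  obtain s t where pp: "p = (s, t)" by (cases p)
  have st: "0 \<le> s" "lam * s < t" "0 < t" using assms TZ_coord_pos by (auto simp: TZ_coord_def pp)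
  have "lam * (lam * t - s) < t"
    unfolding lam_expand
    using st(1,3) lam_le(3)[OF st(1), unfolded lam_expand] lam_less(3)[OF st(3), unfolded lam_expand] by linarith
  then show ?thesis by (auto simp: pp algebra_simps lam_red)
qed

lemma contr_coord_TZ_coord:
  assumes "p \<in> TZ_coord" "m \<in> digits"
  shows "contr_coord m p \<in> TZ_coord"
proof -
  obtain s t where pp: "p = (s, t)" by (cases p)
  have st: "0 \<le> s" "s < 1" "lam * s < t" "t < 1" "0 < t" using assms(1) TZ_coord_pos by (auto simp: TZ_coord_def pp)
  consider "m = 0" | "m = 2" | "m = 3" | "m = 5" using assms by (auto simp: digits_def)
  then show ?thesis
  proof cases
    case 1
    then show ?thesis
      apply (simp only: pp contr_coord.simps TZ_coord_def mem_Collect_eq prod.case if_True if_False refl num_eqs lam_expand)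
      apply (intro conjI)
      subgoal using lam_le(2)[OF st(1), unfolded lam_expand] by linarith
      subgoal using lam_powers(1) lam_less(2)[OF st(2), unfolded lam_expand] by linarith
      subgoal using lam_powers(1) lam_less(2)[OF st(4), unfolded lam_expand] by linarith
      subgoal using lam_less(2)[OF st(3), unfolded lam_expand] by linarith
      done
  next
    case 2
    then show ?thesis
      apply (simp only: pp contr_coord.simps TZ_coord_def mem_Collect_eq prod.case if_True if_False refl num_eqs lam_expand)
      apply (intro conjI)
      subgoal using lam_less(1)[OF st(2), unfolded lam_expand] lam_less(1)[OF st(4), unfolded lam_expand] lam_powers(2) lam_less(3)[OF st(4), unfolded lam_expand] lam_less(4)[OF st(3), unfolded lam_expand] by linarith
      subgoal using lam_powers(2) lam_le(3)[OF st(1), unfolded lam_expand] lam_less(3)[OF st(5), unfolded lam_expand] by linarith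
      subgoal using lam_less(2)[OF st(3), unfolded lam_expand] by linarith
      subgoal using lam_le(2)[OF st(1), unfolded lam_expand] lam_powers(2) lam_less(3)[OF st(4), unfolded lam_expand] by linarith
      done
  next
    case 3
    then show ?thesis
      apply (simp only: pp contr_coord.simps TZ_coord_def mem_Collect_eq prod.case if_True if_False refl num_eqs lam_expand)
      apply (intro conjI)
      subgoal using lam_less(2)[OF st(2), unfolded lam_expand] lam_less(3)[OF st(5), unfolded lam_expand] by linarith
      subgoal using lam_le(2)[OF st(1), unfolded lam_expand] lam_powers(2) lam_less(3)[OF st(4), unfolded lam_expand] by linarith
      subgoal using lam_powers(2) lam_le(3)[OF st(1), unfolded lam_expand] lam_less(3)[OF st(5), unfolded lam_expand] by linarith
      subgoal using lam_less(2)[OF st(4), unfolded lam_expand] by linarith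
      done
  next
    case 4
    then show ?thesis
      apply (simp only: pp contr_coord.simps TZ_coord_def mem_Collect_eq prod.case if_True if_False refl num_eqs lam_expand)
      apply (intro conjI)
      subgoal using lam_le(2)[OF st(1), unfolded lam_expand] by linarith
      subgoal using lam_powers(1) lam_less(2)[OF st(2), unfolded lam_expand] by linarith
      subgoal using lam_less(2)[OF st(4), unfolded lam_expand] by linarith
      subgoal using lam_powers(1) lam_less(2)[OF st(3), unfolded lam_expand] by linarith
      done
  qed
qed

text \<open>
  The renormalisation. Along the tower \<open>F5, F3, F2, F0\<close> the map \<open>S\<close> acts by the isometry that carries
  one level onto the next; from the last level it returns to the first after a step of \<open>S\<close> at the
  large scale. Each image lies on one side of the discontinuity \<open>s = lam * t\<close>, except that of \<open>F0\<close>,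
  where the line is invariant under the scaling.
\<close>

lemma ret_map_contr_coord:
  assumes "p \<in> TZ_coord"
  shows "ret_map (contr_coord 0 p) = contr_coord 5 (ret_map p)" "ret_map (contr_coord 5 p) = contr_coord 3 p" "ret_map (contr_coord 3 p) = contr_coord 2 p" "ret_map (contr_coord 2 p) = contr_coord 0 p"
proof -
  obtain s t where pp: "p = (s, t)" by (cases p)
  have st: "0 \<le> s" "s < 1" "lam * s < t" "t < 1" "0 < t" using assms(1) TZ_coord_pos by (auto simp: TZ_coord_def pp)
  have 0: "(1 - lam) * s \<le> lam * ((1 - lam) * t) \<longleftrightarrow> s \<le> lam * t"
  proof -
    have "lam * ((1 - lam) * t) = (1 - lam) * (lam * t)" by simp
    then show ?thesis using lam_powers(2) by (metis mult_le_cancel_left_pos)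
  qed
  have 2: "lam - (2 * lam - 1) * (s + t) \<le> lam * (1 + (2 * lam - 1) * s - (1 - lam) * t)"
    unfolding lam_expand using lam_le(2)[OF st(1), unfolded lam_expand] by linarith
  have 3: "\<not> 1 - lam + (2 * lam - 1) * t - (1 - lam) * s \<le> lam * (lam - (2 * lam - 1) * (s + t))"
    unfolding lam_expand using lam_less(2)[OF st(3), unfolded lam_expand] by linarith
  have 5: "(1 - lam) * s \<le> lam * ((1 - lam) * t + lam)"
    unfolding lam_expand
    using lam_less(2)[OF st(2), unfolded lam_expand] lam_less(3)[OF st(5), unfolded lam_expand] by linarith
  show "ret_map (contr_coord 0 p) = contr_coord 5 (ret_map p)"
    by (cases "s \<le> lam * t"; simp add: pp 0; simp add: algebra_simps lam_red)
  show "ret_map (contr_coord 5 p) = contr_coord 3 p"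
    by (simp add: pp 5; simp add: algebra_simps lam_red)
  show "ret_map (contr_coord 3 p) = contr_coord 2 p"
    by (simp add: pp 3; simp add: algebra_simps lam_red)
  show "ret_map (contr_coord 2 p) = contr_coord 0 p"
    by (simp add: pp 2; simp add: algebra_simps lam_red)
qed

text \<open>
  The levels \<open>0\<close> and \<open>5\<close> of the tower are separated by \<open>t < lam^2\<close> and \<open>t > lam\<close>. This makes orbits
  strictly longer at the smaller scale.
\<close>

lemma contr_coord_disjoint:
  assumes "p \<in> TZ_coord" "q \<in> TZ_coord"
  shows "contr_coord 0 p \<noteq> contr_coord 5 q"
proof -
  obtain s t s' t' where [simp]: "p = (s, t)" "q = (s', t')" by (cases p, cases q)
  have "t < 1" "0 < t'" using assms TZ_coord_pos by (auto simp: TZ_coord_def)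
  then show ?thesis
    using lam_less(2)[of t 1] lam_less(2)[of 0 t'] lam_powers(3) by (simp; linarith)
qed

text \<open>
  The set of points that stay in \<open>s > lam * t\<close> under \<open>S\<close>; there \<open>S\<close> is a rotation by \<open>-72\<close> degrees.
\<close>

definition pent_right :: "(real \<times> real) set" where
  "pent_right = {(s, t). lam * t < s \<and> lam * s < t \<and> s < 1 \<and> t < 1 \<and> s + t > 1}"

text \<open>
  The set of points that stay in \<open>s \<le> lam * t\<close> under \<open>S\<close>; there \<open>S\<close> is a rotation by \<open>-144\<close> degrees.
\<close>

definition pent_left :: "(real \<times> real) set" where
  "pent_left = {(s, t). 0 \<le> s \<and> s \<le> lam * t \<and> t \<le> lam + lam * s \<and> 1 - lam \<le> t \<and> s + t \<le> 1}"

text \<open>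
  The map permutes the five half planes cyclically.
\<close>

lemma pent_right_ret_map: "p \<in> pent_right \<Longrightarrow> ret_map p \<in> pent_right"
proof -
  assume p: "p \<in> pent_right"
  obtain s t where pp: "p = (s, t)" by (cases p)
  have st: "lam * t < s" "lam * s < t" "s < 1" "t < 1" "s + t > 1" using p by (auto simp: pent_right_def pp)
  have "\<not> s \<le> lam * t" using st by simp
  then show ?thesis
      apply (simp only: pp ret_map.simps pent_right_def mem_Collect_eq prod.case if_True if_False refl num_eqs lam_expand)
      apply (intro conjI)
      subgoal using lam_less(1)[OF st(5), unfolded lam_expand] by linarith
      subgoal using st(3) by linarith
      subgoal using st(4) by linarith
      subgoal using st(1) by linarith
      subgoal using st(2) lam_less(1)[OF st(2), unfolded lam_expand] by linarith
      done
qed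

lemma pent_left_ret_map: "p \<in> pent_left \<Longrightarrow> ret_map p \<in> pent_left"
proof -
  assume p: "p \<in> pent_left"
  obtain s t where pp: "p = (s, t)" by (cases p)
  have st: "0 \<le> s" "s \<le> lam * t" "t \<le> lam + lam * s" "1 - lam \<le> t" "s + t \<le> 1" using p by (auto simp: pent_left_def pp)
  have "s \<le> lam * t" using st by simp
  then show ?thesis
      apply (simp only: pp ret_map.simps pent_left_def mem_Collect_eq prod.case if_True if_False refl num_eqs lam_expand)
      apply (intro conjI)
      subgoal using st(2) by linarith
      subgoal using st(3) by linarith
      subgoal using st(4) by linarith
      subgoal using lam_le(1)[OF st(5), unfolded lam_expand] by linarith
      subgoal using st(1) lam_le(1)[OF st(1), unfolded lam_expand] by linarith
      done
qed

lemma pent_right_period: "p \<in> pent_right \<Longrightarrow> (ret_map ^^ 5) p = p"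
proof -
  define A :: "real \<times> real \<Rightarrow> real \<times> real" where "A = (\<lambda>(s, t). (t, 1 - s + lam * t))"
  have SA: "ret_map p = A p" if "p \<in> pent_right" for p using that by (auto simp: A_def pent_right_def)
  assume p: "p \<in> pent_right"
  have "(ret_map ^^ n) p \<in> pent_right \<and> (ret_map ^^ n) p = (A ^^ n) p" for n
  proof (induction n)
    case (Suc n)
    then show ?case using SA pent_right_ret_map by (metis comp_apply funpow.simps(2))
  qed (use p in simp)
  moreover have "(A ^^ 5) p = p"
    by (cases p) (simp add: eval_nat_numeral A_def algebra_simps lam_red)
  ultimately show ?thesis by metis
qed

lemma pent_left_period: "p \<in> pent_left \<Longrightarrow> (ret_map ^^ 5) p = p"
proof -
  define A :: "real \<times> real \<Rightarrow> real \<times> real" where "A = (\<lambda>(s, t). (lam * t - s, 1 - lam * s - lam * t))"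
  have SA: "ret_map p = A p" if "p \<in> pent_left" for p using that by (auto simp: A_def pent_left_def)
  assume p: "p \<in> pent_left"
  have "(ret_map ^^ n) p \<in> pent_left \<and> (ret_map ^^ n) p = (A ^^ n) p" for n
  proof (induction n)
    case (Suc n)
    then show ?case using SA pent_left_ret_map by (metis comp_apply funpow.simps(2))
  qed (use p in simp)
  moreover have "(A ^^ 5) p = p"
    by (cases p) (simp add: eval_nat_numeral A_def algebra_simps lam_red)
  ultimately show ?thesis by metis
qed

text \<open>
  The inverses of the contractions, with \<open>1 / lam = 1 + lam\<close> and \<open>1 / lam^2 = 2 + lam\<close>.
\<close>

fun contr_coord_inv :: "nat \<Rightarrow> real \<times> real \<Rightarrow> real \<times> real" where
  "contr_coord_inv m (s, t) =
     (if m = 2 then ((1 + lam) * t - (2 + lam) * s, 2 + lam - (1 + lam) * (s + t))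
      else if m = 3 then (1 + lam - (1 + lam) * (s + t), 1 + (1 + lam) * s - (2 + lam) * t)
      else if m = 5 then ((2 + lam) * s, (2 + lam) * t - (1 + lam))
      else ((2 + lam) * s, (2 + lam) * t))"

lemma contr_coord_contr_coord_inv: "contr_coord m (contr_coord_inv m p) = p"
  by (cases p) (simp add: algebra_simps lam_red)

lemma contr_coord_inv_contr_coord: "contr_coord_inv m (contr_coord m p) = p"
  by (cases p) (simp add: algebra_simps lam_red)

lemma contr_coord_inj: "inj (contr_coord m)"
  by (rule injI) (metis contr_coord_inv_contr_coord)

text \<open>
  The discontinuity \<open>s = lam * t\<close> cuts \<open>TZ_coord\<close> into a kite and a triangle. In each of them the
  complement of the invariant pentagon is covered by a few polygons, each of which lies in the
  image of a single contraction. The names of the cases give the side of the discontinuity and the digit.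
\<close>

lemma TZ_coord_cover:
  assumes "p \<in> TZ_coord" "p \<notin> pent_right" "p \<notin> pent_left"
  shows "\<exists>m\<in>digits. contr_coord_inv m p \<in> TZ_coord"
proof -
  obtain s t where pp: "p = (s, t)" by (cases p)
  have st: "0 \<le> s" "s < 1" "lam * s < t" "t < 1" "0 < t" using assms(1) TZ_coord_pos by (auto simp: TZ_coord_def pp)
  consider (Q3) "s > lam * t" "s + t \<le> 1" "s \<ge> 1 - lam"
    | (Q3_upper) "s > lam * t" "s + t \<le> 1" "t \<ge> 1 - lam"
    | (Q0) "s > lam * t" "s + t \<le> 1" "s < 1 - lam" "t < 1 - lam"
    | (D0) "s \<le> lam * t" "t < 1 - lam"
    | (D5) "s \<le> lam * t" "t > lam + lam * s" "s < 1 - lam"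
    | (D2) "s \<le> lam * t" "t > lam + lam * s" "s \<ge> 1 - lam"
    | (D2_lower) "s \<le> lam * t" "t \<le> lam + lam * s" "s + t > 1"
    using assms st unfolding pent_right_def pent_left_def pp mem_Collect_eq prod.case by argo
  then show ?thesis
  proof cases
    case Q3
    have "contr_coord_inv 3 p \<in> TZ_coord"
      apply (simp only: pp contr_coord_inv.simps TZ_coord_def mem_Collect_eq prod.case if_True if_False refl num_eqs lam_expand)
      apply (intro conjI)
      subgoal using Q3(2) lam_le(1)[OF Q3(2), unfolded lam_expand] by linarith
      subgoal using st(5) Q3(3) lam_less(1)[OF st(5), unfolded lam_expand] lam_le(1)[OF Q3(3), unfolded lam_expand] by linarith
      subgoal using st(3) lam_less(1)[OF st(3), unfolded lam_expand] by linarith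
      subgoal using Q3(1) lam_less(1)[OF Q3(1), unfolded lam_expand] by linarith
      done
    then show ?thesis by (auto simp: digits_def)
  next
    case Q3_upper
    have "contr_coord_inv 3 p \<in> TZ_coord"
      apply (simp only: pp contr_coord_inv.simps TZ_coord_def mem_Collect_eq prod.case if_True if_False refl num_eqs lam_expand)
      apply (intro conjI)
      subgoal using Q3_upper(2) lam_le(1)[OF Q3_upper(2), unfolded lam_expand] by linarith
      subgoal using st(1) Q3_upper(1) Q3_upper(3) lam_le(1)[OF st(1), unfolded lam_expand] lam_less(1)[OF st(5), unfolded lam_expand] lam_le(1)[OF Q3_upper(3), unfolded lam_expand] by linarith
      subgoal using st(3) lam_less(1)[OF st(3), unfolded lam_expand] by linarith
      subgoal using Q3_upper(1) lam_less(1)[OF Q3_upper(1), unfolded lam_expand] by linarith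
      done
    then show ?thesis by (auto simp: digits_def)
  next
    case Q0
    have "contr_coord_inv 0 p \<in> TZ_coord"
      apply (simp only: pp contr_coord_inv.simps TZ_coord_def mem_Collect_eq prod.case if_True if_False refl num_eqs lam_expand)
      apply (intro conjI)
      subgoal using st(1) lam_le(1)[OF st(1), unfolded lam_expand] by linarith
      subgoal using Q0(3) lam_less(1)[OF Q0(3), unfolded lam_expand] by linarith
      subgoal using Q0(4) lam_less(1)[OF Q0(4), unfolded lam_expand] by linarith
      subgoal using st(3) lam_less(1)[OF st(3), unfolded lam_expand] by linarith
      done
    then show ?thesis by (auto simp: digits_def)
  next
    case D0
    have "contr_coord_inv 0 p \<in> TZ_coord"
      apply (simp only: pp contr_coord_inv.simps TZ_coord_def mem_Collect_eq prod.case if_True if_False refl num_eqs lam_expand)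
      apply (intro conjI)
      subgoal using st(1) lam_le(1)[OF st(1), unfolded lam_expand] by linarith
      subgoal using st(2) D0(1) D0(2) lam_le(1)[OF D0(1), unfolded lam_expand] lam_less(1)[OF D0(2), unfolded lam_expand] by linarith
      subgoal using D0(2) lam_less(1)[OF D0(2), unfolded lam_expand] by linarith
      subgoal using st(3) lam_less(1)[OF st(3), unfolded lam_expand] by linarith
      done
    then show ?thesis by (auto simp: digits_def)
  next
    case D5
    have "contr_coord_inv 5 p \<in> TZ_coord"
      apply (simp only: pp contr_coord_inv.simps TZ_coord_def mem_Collect_eq prod.case if_True if_False refl num_eqs lam_expand)
      apply (intro conjI)
      subgoal using st(1) lam_le(1)[OF st(1), unfolded lam_expand] by linarith
      subgoal using D5(3) lam_less(1)[OF D5(3), unfolded lam_expand] by linarith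
      subgoal using st(4) lam_less(1)[OF st(4), unfolded lam_expand] by linarith
      subgoal using D5(2) lam_less(1)[OF D5(2), unfolded lam_expand] by linarith
      done
    then show ?thesis by (auto simp: digits_def)
  next
    case D2
    have "contr_coord_inv 2 p \<in> TZ_coord"
      apply (simp only: pp contr_coord_inv.simps TZ_coord_def mem_Collect_eq prod.case if_True if_False refl num_eqs lam_expand)
      apply (intro conjI)
      subgoal using D2(1) lam_le(1)[OF D2(1), unfolded lam_expand] by linarith
      subgoal using st(1) st(4) D2(3) lam_less(1)[OF st(4), unfolded lam_expand] lam_le(1)[OF D2(3), unfolded lam_expand] by linarith
      subgoal using st(5) D2(2) D2(3) lam_less(1)[OF st(5), unfolded lam_expand] lam_less(1)[OF D2(2), unfolded lam_expand] lam_le(1)[OF D2(3), unfolded lam_expand] by linarith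
      subgoal using st(4) lam_less(1)[OF st(4), unfolded lam_expand] by linarith
      done
    then show ?thesis by (auto simp: digits_def)
  next
    case D2_lower
    have "contr_coord_inv 2 p \<in> TZ_coord"
      apply (simp only: pp contr_coord_inv.simps TZ_coord_def mem_Collect_eq prod.case if_True if_False refl num_eqs lam_expand)
      apply (intro conjI)
      subgoal using D2_lower(1) lam_le(1)[OF D2_lower(1), unfolded lam_expand] by linarith
      subgoal using st(1) st(4) D2_lower(2) D2_lower(3) lam_le(1)[OF st(1), unfolded lam_expand] lam_le(1)[OF D2_lower(2), unfolded lam_expand] by linarith
      subgoal using D2_lower(3) lam_less(1)[OF D2_lower(3), unfolded lam_expand] by linarith
      subgoal using st(4) lam_less(1)[OF st(4), unfolded lam_expand] by linarith
      done
    then show ?thesis by (auto simp: digits_def)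
  qed
qed

section \<open>Finite and infinite orbits\<close>

declare T_coord.simps [simp del] ret_map.simps [simp del] contr_coord.simps [simp del] contr_coord_inv.simps [simp del] pt.simps [simp del]

definition orb :: "('a \<Rightarrow> 'a) \<Rightarrow> 'a \<Rightarrow> 'a set" where
  "orb f x = range (\<lambda>n. (f ^^ n) x)"

lemma orb_self [simp]: "x \<in> orb f x"
  unfolding orb_def by (metis funpow_0 rangeI)

lemma orb_step: "y \<in> orb f x \<Longrightarrow> f y \<in> orb f x"
  unfolding orb_def by (auto intro: range_eqI[where x = "Suc n" for n])

lemma orb_subset:
  assumes "x \<in> A" "\<And>y. y \<in> A \<Longrightarrow> f y \<in> A"
  shows "orb f x \<subseteq> A"
proof -
  have "(f ^^ n) x \<in> A" for n by (induction n) (use assms in auto)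
  then show ?thesis by (auto simp: orb_def)
qed

lemma orb_ret_map_TZ_coord: "p \<in> TZ_coord \<Longrightarrow> orb ret_map p \<subseteq> TZ_coord"
  by (rule orb_subset) (auto intro: ret_map_TZ_coord)

lemma orb_contr_coord_subset:
  assumes "p \<in> TZ_coord" "m \<in> digits"
  shows "orb ret_map (contr_coord m p) \<subseteq> (\<Union>k\<in>digits. contr_coord k ` orb ret_map p)"
proof (rule orb_subset)
  show "contr_coord m p \<in> (\<Union>k\<in>digits. contr_coord k ` orb ret_map p)" using assms orb_self[of p ret_map] by blast
next
  fix y assume "y \<in> (\<Union>k\<in>digits. contr_coord k ` orb ret_map p)"
  then obtain k q where k: "k \<in> digits" and q: "q \<in> orb ret_map p" and y: "y = contr_coord k q" by auto
  have "q \<in> TZ_coord" using q orb_ret_map_TZ_coord[OF assms(1)] by blast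
  note rules = ret_map_contr_coord[OF this]
  consider "k = 0" | "k = 2" | "k = 3" | "k = 5" using k by (auto simp: digits_def)
  then show "ret_map y \<in> (\<Union>k\<in>digits. contr_coord k ` orb ret_map p)"
    by cases (use q orb_step[OF q] in \<open>auto simp: y rules digits_def\<close>)
qed

text \<open>
  By the renormalisation, the orbit of a point in the tower visits the level \<open>0\<close> over every point of the
  orbit below it, and it also visits the level \<open>5\<close>.
\<close>

lemma contr_coord_orb_subset:
  assumes "p \<in> TZ_coord" "m \<in> digits"
  shows "contr_coord 0 ` orb ret_map p \<subseteq> orb ret_map (contr_coord m p)" "contr_coord 5 (ret_map p) \<in> orb ret_map (contr_coord m p)"
proof -
  let ?O = "orb ret_map (contr_coord m p)"
  have step: "ret_map y \<in> ?O" if "y \<in> ?O" for y using that by (rule orb_step)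
  have to0: "contr_coord 0 q \<in> ?O" if q: "q \<in> TZ_coord" "contr_coord k q \<in> ?O" and k: "k \<in> digits" for q k
  proof -
    have 2: "contr_coord 0 q \<in> ?O" if "contr_coord 2 q \<in> ?O" using step[OF that] ret_map_contr_coord(4)[OF q(1)] by simp
    have 3: "contr_coord 0 q \<in> ?O" if "contr_coord 3 q \<in> ?O" using 2 step[OF that] ret_map_contr_coord(3)[OF q(1)] by simp
    have 5: "contr_coord 0 q \<in> ?O" if "contr_coord 5 q \<in> ?O" using 3 step[OF that] ret_map_contr_coord(2)[OF q(1)] by simp
    show ?thesis using k q 2 3 5 by (auto simp: digits_def)
  qed
  have "contr_coord 0 ((ret_map ^^ n) p) \<in> ?O \<and> (ret_map ^^ n) p \<in> TZ_coord" for n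
  proof (induction n)
    case 0
    show ?case using to0[of p m] assms by simp
  next
    case (Suc n)
    let ?q = "(ret_map ^^ n) p"
    have "contr_coord 5 (ret_map ?q) \<in> ?O" using step[of "contr_coord 0 ?q"] Suc ret_map_contr_coord(1)[of ?q] by simp
    moreover have "ret_map ?q \<in> TZ_coord" using Suc ret_map_TZ_coord by blast
    ultimately show ?case using to0[of "ret_map ?q" 5] by (simp add: digits_def)
  qed
  then show "contr_coord 0 ` orb ret_map p \<subseteq> ?O" by (auto simp: orb_def)
  then have "contr_coord 0 p \<in> ?O" using orb_self[of p ret_map] by blast
  then show "contr_coord 5 (ret_map p) \<in> ?O" using step[of "contr_coord 0 p"] ret_map_contr_coord(1)[OF assms(1)] by simp
qed

lemma contr_coord_inj_on: "inj_on (contr_coord m) A"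
  using contr_coord_inj by (rule inj_on_subset) simp

lemma finite_orb_contr_coord:
  assumes "p \<in> TZ_coord" "m \<in> digits"
  shows "finite (orb ret_map (contr_coord m p)) \<longleftrightarrow> finite (orb ret_map p)"
proof
  assume "finite (orb ret_map (contr_coord m p))"
  then have "finite (contr_coord 0 ` orb ret_map p)" by (rule finite_subset[OF contr_coord_orb_subset(1)[OF assms]])
  then show "finite (orb ret_map p)" by (simp add: finite_image_iff[OF contr_coord_inj_on])
next
  assume "finite (orb ret_map p)"
  then show "finite (orb ret_map (contr_coord m p))"
    by (intro finite_subset[OF orb_contr_coord_subset[OF assms]]) (simp add: digits_def)
qed

lemma card_orb_contr_coord:
  assumes "p \<in> TZ_coord" "m \<in> digits" "finite (orb ret_map p)"
  shows "card (orb ret_map p) < card (orb ret_map (contr_coord m p))"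
proof -
  have "card (orb ret_map p) = card (contr_coord 0 ` orb ret_map p)"
    by (simp add: card_image contr_coord_inj_on)
  also have "\<dots> < card (orb ret_map (contr_coord m p))"
  proof (rule psubset_card_mono)
    show "finite (orb ret_map (contr_coord m p))" using finite_orb_contr_coord assms by simp
    have "contr_coord 5 (ret_map p) \<notin> contr_coord 0 ` orb ret_map p"
      using contr_coord_disjoint orb_ret_map_TZ_coord[OF assms(1)] ret_map_TZ_coord[OF assms(1)] by (metis image_iff subsetD)
    then show "contr_coord 0 ` orb ret_map p \<subset> orb ret_map (contr_coord m p)"
      using contr_coord_orb_subset[OF assms(1,2)] by blast
  qed
  finally show ?thesis .
qed

text \<open>
  A point that can be desubstituted for ever is aperiodic: the lengths of finite orbits would form an
  infinite decreasing sequence.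
\<close>

lemma infinite_orb_of_depth:
  assumes "I \<subseteq> TZ_coord" and desc: "\<And>y. y \<in> I \<Longrightarrow> \<exists>m\<in>digits. \<exists>z\<in>I. y = contr_coord m z"
    and "y \<in> I"
  shows "infinite (orb ret_map y)"
proof
  assume "finite (orb ret_map y)"
  with \<open>y \<in> I\<close> show False
  proof (induction "card (orb ret_map y)" arbitrary: y rule: less_induct)
    case less
    obtain m z where mz: "m \<in> digits" "z \<in> I" "y = contr_coord m z" using desc less by blast
    then have "finite (orb ret_map z)" "card (orb ret_map z) < card (orb ret_map y)"
      using less finite_orb_contr_coord card_orb_contr_coord assms(1) by (metis subsetD)+
    then show False using less mz by blast
  qed
qed

text \<open>
  Since \<open>T\<close> is injective, having a finite orbit is the same as being periodic; finiteness of orbits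
  passes more easily from \<open>T\<close> to its return map \<open>S\<close>.
\<close>

definition aper_coord :: "(real \<times> real) set" where
  "aper_coord = {p \<in> TZ_coord. infinite (orb ret_map p)}"

lemma funpow_period_finite_orb:
  assumes "(f ^^ n) x = x" "n > 0"
  shows "finite (orb f x)"
proof -
  have "orb f x \<subseteq> (\<lambda>k. (f ^^ k) x) ` {..<n}"
    unfolding orb_def using funpow_mod_eq[OF assms(1)] assms(2)
    by (metis (no_types, lifting) image_iff image_subsetI lessThan_iff mod_less_divisor)
  then show ?thesis by (rule finite_subset) simp
qed

text \<open>
  A point outside the images of the contractions lies in an invariant pentagon and is periodic.
\<close>

lemma aper_coord_eq: "aper_coord = (\<Union>m\<in>digits. contr_coord m ` aper_coord)"
proof (intro equalityI subsetI)
  fix p assume p: "p \<in> aper_coord"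
  then have "p \<notin> pent_right" "p \<notin> pent_left" "p \<in> TZ_coord"
    using funpow_period_finite_orb[of 5 ret_map p] pent_right_period[of p] pent_left_period[of p] by (auto simp: aper_coord_def simp del: funpow.simps)
  then obtain m where m: "m \<in> digits" "contr_coord_inv m p \<in> TZ_coord" using TZ_coord_cover by blast
  then have "contr_coord_inv m p \<in> aper_coord" "p = contr_coord m (contr_coord_inv m p)"
    using finite_orb_contr_coord[OF m(2,1)] p contr_coord_contr_coord_inv by (auto simp: aper_coord_def)
  then show "p \<in> (\<Union>m\<in>digits. contr_coord m ` aper_coord)" using m by blast
next
  fix p assume "p \<in> (\<Union>m\<in>digits. contr_coord m ` aper_coord)"
  then show "p \<in> aper_coord" using finite_orb_contr_coord contr_coord_TZ_coord by (auto simp: aper_coord_def)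
qed

text \<open>
  Between two returns to \<open>TZ_coord\<close> at most one point of the orbit lies outside.
\<close>

lemma finite_orb_T_coord_iff:
  assumes "p \<in> TZ_coord"
  shows "finite (orb T_coord p) \<longleftrightarrow> finite (orb ret_map p)"
proof
  have "orb ret_map p \<subseteq> orb T_coord p \<inter> TZ_coord"
  proof (rule orb_subset)
    fix y assume "y \<in> orb T_coord p \<inter> TZ_coord"
    then show "ret_map y \<in> orb T_coord p \<inter> TZ_coord" using ret_map_T_coord ret_map_TZ_coord orb_step by (metis Int_iff)
  qed (use assms in auto)
  then show "finite (orb T_coord p) \<Longrightarrow> finite (orb ret_map p)" using finite_subset[of "orb ret_map p" "orb T_coord p"] by simp
next
  have "orb T_coord p \<subseteq> orb ret_map p \<union> T_coord ` orb ret_map p"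
  proof (rule orb_subset)
    fix y assume "y \<in> orb ret_map p \<union> T_coord ` orb ret_map p"
    then show "T_coord y \<in> orb ret_map p \<union> T_coord ` orb ret_map p"
    proof
      assume "y \<in> T_coord ` orb ret_map p"
      then obtain q where q: "q \<in> orb ret_map p" "y = T_coord q" by auto
      then have "q \<in> TZ_coord" using orb_ret_map_TZ_coord[OF assms] by blast
      then have "ret_map q = y \<or> ret_map q = T_coord y" using ret_map_T_coord q by metis
      then show ?thesis using orb_step[OF q(1)] by force
    qed auto
  qed auto
  then show "finite (orb ret_map p) \<Longrightarrow> finite (orb T_coord p)" by (rule finite_subset) simp
qed

lemma periodic_orbit_pt:
  assumes "p \<in> unit_square"
  shows "periodic_orbit (pt p) \<longleftrightarrow> finite (orb T_coord p)"
proof -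
  have unit_square: "(T_coord ^^ n) p \<in> unit_square" for n by (induction n) (use assms T_coord_unit_square in auto)
  have pow: "(T_map ^^ n) (pt p) = pt ((T_coord ^^ n) p)" for n
    by (induction n) (auto simp: T_map_pt unit_square)
  have cancel: "(T_coord ^^ k) p = p" if "(T_coord ^^ (n + k)) p = (T_coord ^^ n) p" for n k
    using that
  proof (induction n)
    case (Suc n)
    then have "(T_coord ^^ (n + k)) p = (T_coord ^^ n) p" using T_coord_inj unit_square by (simp add: inj_on_def)
    then show ?case by (rule Suc.IH)
  qed simp
  show ?thesis
  proof
    assume "periodic_orbit (pt p)"
    then obtain k where "k > 0" "(T_map ^^ (0 + k)) (pt p) = (T_map ^^ 0) (pt p)"
      unfolding periodic_orbit_def by blast
    then have "(T_coord ^^ k) p = p" by (simp add: pow)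
    then show "finite (orb T_coord p)" using \<open>k > 0\<close> by (rule funpow_period_finite_orb)
  next
    assume "finite (orb T_coord p)"
    then have "\<not> inj (\<lambda>n. (T_coord ^^ n) p)" unfolding orb_def using finite_imageD[of _ UNIV] infinite_UNIV_nat by blast
    then obtain i j where "i \<noteq> j" "(T_coord ^^ i) p = (T_coord ^^ j) p" unfolding inj_def by blast
    then obtain i j where "i < j" "(T_coord ^^ j) p = (T_coord ^^ i) p" by (metis linorder_neqE_nat)
    then have "(T_coord ^^ (j - i)) p = p" "j - i > 0" using cancel[of i "j - i"] by auto
    then show "periodic_orbit (pt p)"
      unfolding periodic_orbit_def pow by (metis comp_apply funpow_add)
  qed
qed

lemma aperiodic_TZ: "aperiodic_points \<inter> T_map ` Z_set = pt ` aper_coord"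
proof -
  have "p \<in> aper_coord \<longleftrightarrow> p \<in> TZ_coord \<and> \<not> periodic_orbit (pt p)" for p
    using periodic_orbit_pt[of p] finite_orb_T_coord_iff[of p] TZ_coord_unit_square by (auto simp: aper_coord_def)
  then show ?thesis using TZ_coord_unit_square by (auto simp: T_Z_pt aperiodic_points_def)
qed

section \<open>Values of digit words and the attractor\<close>

text \<open>
  The composition of the contractions along the first \<open>n\<close> letters.
\<close>

primrec word_map :: "(nat \<Rightarrow> nat) \<Rightarrow> nat \<Rightarrow> complex \<Rightarrow> complex" where
  "word_map w 0 z = z"
| "word_map w (Suc n) z = contr (w 0) (word_map (\<lambda>i. w (Suc i)) n z)"

lemma nested_word_map: "nested w n = word_map w n 0"
  by (induction n arbitrary: w) (simp_all add: contr_def)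

lemma word_map_Suc_right: "word_map w (Suc n) z = word_map w n (contr (w n) z)"
proof (induction n arbitrary: w)
  case (Suc n)
  have "word_map w (Suc (Suc n)) z = contr (w 0) (word_map (\<lambda>i. w (Suc i)) (Suc n) z)" by simp
  also have "\<dots> = word_map w (Suc n) (contr (w (Suc n)) z)" unfolding Suc by simp
  finally show ?case .
qed simp

lemma dist_contr: "dist (contr m x) (contr m y) = (1 - lam) * dist x y"
proof -
  have "contr m x - contr m y = zeta ^ m * of_real (1 / omega ^ 2) * (x - y)"
    by (simp add: contr_def diff_divide_distrib algebra_simps)
  also have "norm \<dots> = (1 - lam) * norm (x - y)"
    unfolding inverse_omega_sq using lam_bounds by (simp add: norm_mult norm_power del: of_real_diff)
  finally show ?thesis by (simp add: dist_norm)
qed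

lemma dist_word_map: "dist (word_map w n x) (word_map w n y) = (1 - lam) ^ n * dist x y"
  by (induction n arbitrary: w) (simp_all add: dist_contr)

lemma omega_pos: "omega > 1"
  using omega_lam lam_powers by simp

lemma norm_d_shift: "norm (d_shift m) \<le> 1"
  using omega_pos by (simp add: d_shift_def norm_divide norm_mult)

lemma norm_contr:
  assumes "norm x \<le> 2"
  shows "norm (contr m x) \<le> 2"
proof -
  have "norm (contr m x) \<le> norm (contr m x - contr m 0) + norm (contr m 0)"
    by (metis add.commute norm_triangle_sub)
  moreover have "norm (contr m x - contr m 0) = (1 - lam) * norm x"
    using dist_contr[of m x 0] by (simp add: dist_norm)
  moreover have "(1 - lam) * norm x \<le> (2 / 5) * 2"
    using assms lam_bounds by (intro mult_mono) auto
  moreover have "norm (contr m 0) \<le> 1" using norm_d_shift by (simp add: contr_def)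
  ultimately show ?thesis using lam_bounds by linarith
qed

lemma norm_word_map: "norm x \<le> 2 \<Longrightarrow> norm (word_map w n x) \<le> 2"
  by (induction n arbitrary: w) (auto intro: norm_contr)

lemma lam_pow_tendsto: "(\<lambda>n. (1 - lam) ^ n * c) \<longlonglongrightarrow> 0"
  using lam_bounds by (intro tendsto_mult_left_zero LIMSEQ_realpow_zero) auto

definition val :: "(nat \<Rightarrow> nat) \<Rightarrow> complex" where
  "val w = lim (nested w)"

lemma nested_tendsto: "nested w \<longlonglongrightarrow> val w"
proof -
  have "dist (nested w n) (nested w (n + k)) \<le> (1 - lam) ^ n * 2" for n k
  proof -
    have "word_map w (n + k) 0 = word_map w n (word_map (\<lambda>i. w (n + i)) k 0)"
      by (induction n arbitrary: w) simp_all
    then have "dist (nested w n) (nested w (n + k)) = (1 - lam) ^ n * norm (word_map (\<lambda>i. w (n + i)) k 0)"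
      by (simp add: nested_word_map dist_word_map)
    then show ?thesis using norm_word_map[of 0] lam_powers by (simp add: mult_left_mono)
  qed
  moreover have "\<exists>M. \<forall>n\<ge>M. (1 - lam) ^ n * 2 < e" if "e > 0" for e
    using order_tendstoD(2)[OF lam_pow_tendsto that] by (auto simp: eventually_sequentially)
  ultimately have "Cauchy (nested w)"
    unfolding Cauchy_altdef2 by (metis dist_commute le_iff_add order_le_less_trans)
  then show ?thesis by (simp add: val_def Cauchy_convergent_iff convergent_LIMSEQ_iff)
qed

lemma val_eqI: "nested w \<longlonglongrightarrow> x \<Longrightarrow> val w = x"
  using nested_tendsto LIMSEQ_unique by blast

lemma is_address_val: "is_address w x \<longleftrightarrow> (\<forall>i. w i \<in> digits) \<and> val w = x"
  using nested_tendsto val_eqI by (auto simp: is_address_def)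

lemma continuous_contr: "continuous_on A (contr m)"
  unfolding contr_def by (intro continuous_intros) (use omega_pos in auto)

lemma val_step: "val w = contr (w 0) (val (\<lambda>i. w (Suc i)))"
proof (rule val_eqI)
  have "(\<lambda>n. contr (w 0) (nested (\<lambda>i. w (Suc i)) n)) \<longlonglongrightarrow> contr (w 0) (val (\<lambda>i. w (Suc i)))"
    using continuous_on_tendsto_compose[OF continuous_contr[of UNIV] nested_tendsto] by simp
  then have "(\<lambda>n. nested w (Suc n)) \<longlonglongrightarrow> contr (w 0) (val (\<lambda>i. w (Suc i)))"
    by (simp add: nested_word_map)
  then show "nested w \<longlonglongrightarrow> contr (w 0) (val (\<lambda>i. w (Suc i)))" by (rule LIMSEQ_imp_Suc)
qed

lemma val_word_map: "val w = word_map w n (val (\<lambda>i. w (n + i)))"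
proof (induction n arbitrary: w)
  case (Suc n)
  show ?case by (subst val_step, subst Suc) simp
qed simp

lemma norm_val: "norm (val w) \<le> 2"
  using nested_tendsto by (rule Lim_norm_ubound[OF sequentially_bot]) (simp add: nested_word_map norm_word_map)

text \<open>
  The starting points may vary with \<open>n\<close>, because the maps contract by a fixed factor.
\<close>

lemma word_map_tendsto:
  assumes "\<And>n. norm (z n) \<le> c"
  shows "(\<lambda>n. word_map w n (z n)) \<longlonglongrightarrow> val w"
proof -
  have "dist (word_map w n (z n)) (val w) \<le> (1 - lam) ^ n * (c + 2)" for n
  proof -
    have "dist (word_map w n (z n)) (val w) = (1 - lam) ^ n * dist (z n) (val (\<lambda>i. w (n + i)))"
      by (subst val_word_map[of w n]) (rule dist_word_map)
    also have "dist (z n) (val (\<lambda>i. w (n + i))) \<le> c + 2"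
      using assms[of n] norm_val[of "\<lambda>i. w (n + i)"] norm_triangle_ineq4
      unfolding dist_norm by (metis add_mono order_trans)
    finally show ?thesis using lam_powers by (simp add: mult_left_mono)
  qed
  then show ?thesis
    by (intro metric_tendsto_imp_tendsto[OF lam_pow_tendsto[of "c + 2"]])
      (auto intro!: always_eventually simp: dist_norm intro: order_trans[OF _ abs_ge_self])
qed

definition digit_words :: "(nat \<Rightarrow> nat) set" where
  "digit_words = {w. \<forall>i. w i \<in> digits}"

text \<open>
  Choosing for each point of \<open>Y\<close> a digit and a preimage in \<open>Y\<close>, and iterating this choice, produces
  an address. The tails of this address are the addresses chosen for the iterated preimages.
\<close>

lemma val_addressing:
  assumes "bounded Y" "Y \<subseteq> (\<Union>m\<in>digits. contr m ` Y)" "x \<in> Y"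
  obtains w where "w \<in> digit_words" "val w = x" "\<And>n. val (\<lambda>i. w (n + i)) \<in> Y"
proof -
  have "\<forall>y\<in>Y. \<exists>m z. m \<in> digits \<and> z \<in> Y \<and> y = contr m z" using assms(2) by blast
  then obtain dig nxt where dn: "\<And>y. y \<in> Y \<Longrightarrow> dig y \<in> digits \<and> nxt y \<in> Y \<and> y = contr (dig y) (nxt y)"
    by metis
  define ad where "ad x = (\<lambda>i. dig ((nxt ^^ i) x))" for x
  have Y: "(nxt ^^ n) y \<in> Y" if "y \<in> Y" for y n
    by (induction n) (use that dn in auto)
  obtain c where c: "\<And>y. y \<in> Y \<Longrightarrow> norm y \<le> c" using assms(1) by (auto simp: bounded_iff)
  have ad: "val (ad y) = y" if "y \<in> Y" for y
  proof -
    have "word_map (ad y) n ((nxt ^^ n) y) = y" for n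
    proof (induction n)
      case (Suc n)
      have "word_map (ad y) (Suc n) ((nxt ^^ Suc n) y) = word_map (ad y) n ((nxt ^^ n) y)"
        unfolding word_map_Suc_right using dn[OF Y[OF that, of n]] by (simp add: ad_def)
      then show ?case using Suc by simp
    qed simp
    moreover have "(\<lambda>n. word_map (ad y) n ((nxt ^^ n) y)) \<longlonglongrightarrow> val (ad y)"
      by (rule word_map_tendsto) (rule c[OF Y[OF that]])
    ultimately show ?thesis by (simp add: LIMSEQ_const_iff)
  qed
  have "(\<lambda>i. ad x (n + i)) = ad ((nxt ^^ n) x)" for n
    by (simp add: ad_def fun_eq_iff add.commute[of n] funpow_add)
  then have "val (\<lambda>i. ad x (n + i)) \<in> Y" for n using ad Y assms(3) by simp
  moreover have "ad x \<in> digit_words" using dn Y assms(3) by (simp add: digit_words_def ad_def)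
  ultimately show ?thesis using that ad assms(3) by blast
qed

lemma word_map_in:
  assumes "\<And>m y. m \<in> digits \<Longrightarrow> y \<in> Y \<Longrightarrow> contr m y \<in> Y" "w \<in> digit_words" "y \<in> Y"
  shows "word_map w n y \<in> Y"
  using assms(2) by (induction n arbitrary: w) (use assms in \<open>auto simp: digit_words_def\<close>)

lemma val_in:
  assumes "closed Y" "Y \<noteq> {}" "\<And>m y. m \<in> digits \<Longrightarrow> y \<in> Y \<Longrightarrow> contr m y \<in> Y" "w \<in> digit_words"
  shows "val w \<in> Y"
proof -
  obtain y where "y \<in> Y" using assms(2) by blast
  then have "\<forall>n. word_map w n y \<in> Y" using word_map_in assms by blast
  moreover have "(\<lambda>n. word_map w n y) \<longlonglongrightarrow> val w" by (rule word_map_tendsto) (rule order_refl)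
  ultimately show ?thesis using assms(1) by (metis closed_sequentially)
qed

lemma val_image_step: "val ` digit_words = (\<Union>m\<in>digits. contr m ` val ` digit_words)"
proof (intro equalityI subsetI)
  fix x assume "x \<in> val ` digit_words"
  then obtain w where w: "w \<in> digit_words" "x = val w" by blast
  then have "x = contr (w 0) (val (\<lambda>i. w (Suc i)))" using val_step[of w] by metis
  moreover have "w 0 \<in> digits" "(\<lambda>i. w (Suc i)) \<in> digit_words" using w by (auto simp: digit_words_def)
  ultimately show "x \<in> (\<Union>m\<in>digits. contr m ` val ` digit_words)" by blast
next
  fix x assume "x \<in> (\<Union>m\<in>digits. contr m ` val ` digit_words)"
  then obtain m w where mw: "m \<in> digits" "w \<in> digit_words" "x = contr m (val w)" by blast
  then have "x = val (case_nat m w)" using val_step[of "case_nat m w"] by simp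
  moreover have "case_nat m w \<in> digit_words" using mw by (auto simp: digit_words_def split: nat.split)
  ultimately show "x \<in> val ` digit_words" by blast
qed

lemma finite_digits: "finite digits"
  by (simp add: digits_def)

text \<open>
  The closure of the set of values is contained in the union of its images, so by \<open>val_addressing\<close>
  its points are themselves values.
\<close>

lemma compact_val: "compact (val ` digit_words)"
proof -
  let ?V = "val ` digit_words"
  have bd: "bounded ?V" using norm_val by (auto simp: bounded_iff)
  have cp: "compact (\<Union>m\<in>digits. contr m ` closure ?V)"
    using bd by (intro compact_UN finite_digits compact_continuous_image continuous_contr) (simp add: compact_closure)
  have "?V \<subseteq> (\<Union>m\<in>digits. contr m ` closure ?V)"
    using val_image_step closure_subset[of ?V] by blast
  then have sub: "closure ?V \<subseteq> (\<Union>m\<in>digits. contr m ` closure ?V)"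
    using cp by (intro closure_minimal compact_imp_closed)
  have "closure ?V \<subseteq> ?V"
  proof
    fix x assume "x \<in> closure ?V"
    then obtain w where "w \<in> digit_words" "val w = x"
      by (rule val_addressing[OF bounded_closure[OF bd] sub]) (rule that)
    then show "x \<in> ?V" by blast
  qed
  then have "closed ?V" by (simp only: closure_subset_eq)
  then show ?thesis using bd by (simp only: compact_eq_bounded_closed)
qed

lemma attractor_val: "attractor = val ` digit_words"
  unfolding attractor_def
proof (rule the_equality)
  have "(\<lambda>_. 0) \<in> digit_words" by (simp add: digit_words_def digits_def)
  then show "compact (val ` digit_words) \<and> val ` digit_words \<noteq> {} \<and>
      val ` digit_words = (\<Union>m\<in>digits. contr m ` val ` digit_words)"
    using compact_val val_image_step by blast
next
  fix Y assume Y: "compact Y \<and> Y \<noteq> {} \<and> Y = (\<Union>m\<in>digits. contr m ` Y)"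
  then have sub: "Y \<subseteq> (\<Union>m\<in>digits. contr m ` Y)" and ne: "Y \<noteq> {}" and "bounded Y" "closed Y"
    by (auto intro: compact_imp_bounded compact_imp_closed)
  have into: "contr m y \<in> Y" if "m \<in> digits" "y \<in> Y" for m y
  proof -
    have "contr m y \<in> (\<Union>m\<in>digits. contr m ` Y)" using that by blast
    with Y show ?thesis by simp
  qed
  show "Y = val ` digit_words"
  proof (intro equalityI subsetI)
    fix x assume "x \<in> Y"
    then obtain w where "w \<in> digit_words" "val w = x"
      by (rule val_addressing[OF \<open>bounded Y\<close> sub]) (rule that)
    then show "x \<in> val ` digit_words" by blast
  next
    fix x assume "x \<in> val ` digit_words"
    then show "x \<in> Y" using val_in[OF \<open>closed Y\<close> ne into] by blast
  qed
qed

section \<open>Coding the aperiodic points\<close>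

text \<open>
  The letters \<open>2\<close> and \<open>5\<close> begin the words with value on the leg \<open>t = 1\<close>, the letters \<open>0\<close> and \<open>3\<close>
  those with value on the leg \<open>t = lam * s\<close>. The maps \<open>F5\<close> and \<open>F0\<close> send a part of their leg to itself,
  while \<open>F2\<close> sends the bottom leg into the top one and \<open>F3\<close> the top leg into the bottom one.
\<close>

definition leg_pair :: "nat \<Rightarrow> nat \<Rightarrow> bool" where
  "leg_pair a b \<longleftrightarrow> (if a \<in> {3, 5} then b \<in> {2, 5} else b \<in> {0, 3})"

definition top_leg :: "(real \<times> real) set" where "top_leg = (\<lambda>s. (s, 1)) ` {0..1}"
definition bot_leg :: "(real \<times> real) set" where "bot_leg = (\<lambda>s. (s, lam * s)) ` {0..1}"
definition leg :: "nat \<Rightarrow> (real \<times> real) set" where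
  "leg m = (if m \<in> {2, 5} then top_leg else bot_leg)"

definition trapezium :: "(real \<times> real) set" where
  "trapezium = {(s, t). 0 \<le> s \<and> s \<le> 1 \<and> lam * s \<le> t \<and> t \<le> 1}"

lemma pt_altdef: "pt p = of_real (fst p) - of_real (snd p) * inverse zeta"
  by (cases p) (simp add: pt.simps)

lemma continuous_pt: "continuous_on A pt"
  unfolding pt_altdef by (intro continuous_intros)

lemma trapezium_pos: "(s, t) \<in> trapezium \<Longrightarrow> 0 \<le> t"
  using lam_le(1)[of 0 s] by (auto simp: trapezium_def)

lemma compact_trapezium: "compact (pt ` trapezium)"
proof -
  have "trapezium = {p. 0 \<le> fst p} \<inter> {p. fst p \<le> 1} \<inter> {p. lam * fst p \<le> snd p} \<inter> {p. snd p \<le> 1}"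
    by (auto simp: trapezium_def)
  also have "closed \<dots>"
    by (intro closed_Int closed_Collect_le continuous_intros)
  finally have "closed trapezium" .
  moreover have "trapezium \<subseteq> {0..1} \<times> {0..1}"
    using trapezium_pos by (auto simp: trapezium_def)
  then have "bounded trapezium"
    using bounded_Times[OF bounded_closed_interval bounded_closed_interval] bounded_subset by blast
  ultimately show ?thesis
    by (intro compact_continuous_image continuous_pt) (simp add: compact_eq_bounded_closed)
qed

lemma closed_leg: "closed (pt ` leg m)"
proof -
  have "compact (leg m)"
    unfolding leg_def top_leg_def bot_leg_def
    by (auto intro!: compact_continuous_image continuous_intros)
  then show ?thesis by (intro compact_imp_closed compact_continuous_image continuous_pt)
qed

lemma mem_legs:
  "(s, t) \<in> top_leg \<longleftrightarrow> 0 \<le> s \<and> s \<le> 1 \<and> t = 1"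
  "(s, t) \<in> bot_leg \<longleftrightarrow> 0 \<le> s \<and> s \<le> 1 \<and> t = lam * s"
  by (auto simp: top_leg_def bot_leg_def)

text \<open>
  Up to the factor \<open>lam^2\<close>, the distance of the image from a leg is the distance of the point from
  the leg that is carried there.
\<close>

lemma contr_coord_leg_distance:
  "1 - snd (contr_coord 5 (s, t)) = (1 - lam) * (1 - t)"
  "1 - snd (contr_coord 2 (s, t)) = (1 - lam) * (t - lam * s)"
  "snd (contr_coord 0 (s, t)) - lam * fst (contr_coord 0 (s, t)) = (1 - lam) * (t - lam * s)"
  "snd (contr_coord 3 (s, t)) - lam * fst (contr_coord 3 (s, t)) = (1 - lam) * (1 - t)"
  by (simp_all add: contr_coord.simps algebra_simps lam_red)

lemma contr_coord_trapezium:
  assumes "p \<in> trapezium" "m \<in> digits"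
  shows "contr_coord m p \<in> trapezium" "fst (contr_coord m p) < 1"
proof -
  obtain s t where pp: "p = (s, t)" by (cases p)
  have st: "0 \<le> s" "s \<le> 1" "lam * s \<le> t" "t \<le> 1" "0 \<le> t"
    using assms(1) trapezium_pos[of s t] by (simp_all add: trapezium_def pp)
  consider "m = 0" | "m = 2" | "m = 3" | "m = 5" using assms by (auto simp: digits_def)
  then have "contr_coord m p \<in> trapezium \<and> fst (contr_coord m p) < 1"
  proof cases
    case 1
    show ?thesis
      apply (simp only: \<open>m = 0\<close> pp contr_coord.simps trapezium_def mem_Collect_eq prod.case fst_conv if_True if_False refl num_eqs lam_expand)
      apply (intro conjI)
      subgoal using lam_le(2)[OF st(1), unfolded lam_expand] by linarith
      subgoal using lam_powers(1) lam_le(2)[OF st(2), unfolded lam_expand] by linarith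
      subgoal using lam_le(2)[OF st(3), unfolded lam_expand] by linarith
      subgoal using lam_powers(1) lam_le(2)[OF st(4), unfolded lam_expand] by linarith
      subgoal using lam_powers(1) lam_le(2)[OF st(2), unfolded lam_expand] by linarith
      done
  next
    case 2
    show ?thesis
      apply (simp only: \<open>m = 2\<close> pp contr_coord.simps trapezium_def mem_Collect_eq prod.case fst_conv if_True if_False refl num_eqs lam_expand)
      apply (intro conjI)
      subgoal using lam_le(3)[OF st(2), unfolded lam_expand] lam_le(3)[OF st(4), unfolded lam_expand] lam_powers(4) by linarith
      subgoal using lam_powers(2) lam_le(3)[OF st(1), unfolded lam_expand] lam_le(3)[OF st(5), unfolded lam_expand] by linarith
      subgoal using lam_le(2)[OF st(1), unfolded lam_expand] lam_powers(2) lam_le(3)[OF st(4), unfolded lam_expand] by linarith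
      subgoal using lam_le(2)[OF st(3), unfolded lam_expand] by linarith
      subgoal using lam_powers(2) lam_le(3)[OF st(1), unfolded lam_expand] lam_le(3)[OF st(5), unfolded lam_expand] by linarith
      done
  next
    case 3
    show ?thesis
      apply (simp only: \<open>m = 3\<close> pp contr_coord.simps trapezium_def mem_Collect_eq prod.case fst_conv if_True if_False refl num_eqs lam_expand)
      apply (intro conjI)
      subgoal using lam_le(2)[OF st(2), unfolded lam_expand] lam_le(3)[OF st(5), unfolded lam_expand] by linarith
      subgoal using lam_le(2)[OF st(1), unfolded lam_expand] lam_powers(2) lam_le(3)[OF st(4), unfolded lam_expand] by linarith
      subgoal using lam_le(2)[OF st(4), unfolded lam_expand] by linarith
      subgoal using lam_powers(2) lam_le(3)[OF st(1), unfolded lam_expand] lam_le(3)[OF st(5), unfolded lam_expand] by linarith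
      subgoal using lam_le(2)[OF st(1), unfolded lam_expand] lam_powers(2) lam_le(3)[OF st(4), unfolded lam_expand] by linarith
      done
  next
    case 4
    show ?thesis
      apply (simp only: \<open>m = 5\<close> pp contr_coord.simps trapezium_def mem_Collect_eq prod.case fst_conv if_True if_False refl num_eqs lam_expand)
      apply (intro conjI)
      subgoal using lam_le(2)[OF st(1), unfolded lam_expand] by linarith
      subgoal using lam_powers(1) lam_le(2)[OF st(2), unfolded lam_expand] by linarith
      subgoal using lam_powers(1) lam_le(2)[OF st(3), unfolded lam_expand] by linarith
      subgoal using lam_le(2)[OF st(4), unfolded lam_expand] by linarith
      subgoal using lam_powers(1) lam_le(2)[OF st(2), unfolded lam_expand] by linarith
      done
  qed
  then show "contr_coord m p \<in> trapezium" "fst (contr_coord m p) < 1" by auto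
qed

lemma contr_coord_in_leg:
  assumes "p \<in> trapezium" "m \<in> digits"
  shows "contr_coord m p \<in> top_leg \<Longrightarrow> m = 5 \<and> p \<in> top_leg \<or> m = 2 \<and> p \<in> bot_leg"
    "contr_coord m p \<in> bot_leg \<Longrightarrow> m = 0 \<and> p \<in> bot_leg \<or> m = 3 \<and> p \<in> top_leg"
proof -
  obtain s t where pp: "p = (s, t)" by (cases p)
  have st: "0 \<le> s" "s \<le> 1" "lam * s \<le> t" "t \<le> 1" "0 \<le> t"
    using assms(1) trapezium_pos[of s t] by (simp_all add: trapezium_def pp)
  have nz: "1 - lam \<noteq> 0" using lam_powers by simp
  have top: "snd q = 1" if "q \<in> top_leg" for q using that by (auto simp: top_leg_def)
  have bot: "snd q = lam * fst q" if "q \<in> bot_leg" for q using that by (auto simp: bot_leg_def)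
  have top0: "snd (contr_coord 0 p) < 1"
    apply (simp only: pp contr_coord.simps num_eqs if_True if_False refl snd_conv lam_expand)
    subgoal using lam_powers(1) lam_le(2)[OF st(4), unfolded lam_expand] by linarith
    done
  have top3: "snd (contr_coord 3 p) < 1"
    apply (simp only: pp contr_coord.simps num_eqs if_True if_False refl snd_conv lam_expand)
    subgoal using lam_powers(2) lam_le(3)[OF st(1), unfolded lam_expand] lam_le(3)[OF st(5), unfolded lam_expand] by linarith
    done
  have bot5: "lam * fst (contr_coord 5 p) < snd (contr_coord 5 p)"
    apply (simp only: pp contr_coord.simps num_eqs if_True if_False refl fst_conv snd_conv lam_expand)
    subgoal using lam_powers(1) lam_le(2)[OF st(3), unfolded lam_expand] by linarith
    done
  have bot2: "lam * fst (contr_coord 2 p) < snd (contr_coord 2 p)"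
    apply (simp only: pp contr_coord.simps num_eqs if_True if_False refl fst_conv snd_conv lam_expand)
    subgoal using lam_le(2)[OF st(1), unfolded lam_expand] lam_powers(2) lam_le(3)[OF st(4), unfolded lam_expand] by linarith
    done
  have m: "m = 0 \<or> m = 2 \<or> m = 3 \<or> m = 5" using assms by (auto simp: digits_def)
  show "m = 5 \<and> p \<in> top_leg \<or> m = 2 \<and> p \<in> bot_leg" if "contr_coord m p \<in> top_leg"
    using m top[OF that] top0 top3 contr_coord_leg_distance(1,2)[of s t] nz st
    by (elim disjE) (simp_all add: pp mem_legs)
  show "m = 0 \<and> p \<in> bot_leg \<or> m = 3 \<and> p \<in> top_leg" if "contr_coord m p \<in> bot_leg"
    using m bot[OF that] bot5 bot2 contr_coord_leg_distance(3,4)[of s t] nz st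
    by (elim disjE) (simp_all add: pp mem_legs)
qed

lemma contr_coord_leg:
  assumes "leg_pair a b" "p \<in> leg b" "a \<in> digits"
  shows "contr_coord a p \<in> leg a"
proof -
  obtain s t where pp: "p = (s, t)" by (cases p)
  have "lam * s \<le> 1" if "0 \<le> s" "s \<le> 1"
    using that lam_bounds by (simp add: mult_le_one)
  then have "p \<in> trapezium"
    using assms(2)
    by (auto simp: leg_def mem_legs trapezium_def pp split: if_splits)
  then obtain s' t' where f: "contr_coord a p = (s', t')" "0 \<le> s'" "s' \<le> 1"
    using contr_coord_trapezium(1)[of p a] assms(3) by (auto simp: trapezium_def)
  have a: "a = 0 \<or> a = 2 \<or> a = 3 \<or> a = 5" using assms by (auto simp: digits_def)
  show ?thesis
    using a assms(1,2) f contr_coord_leg_distance[of s t]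
    by (elim disjE) (auto simp: leg_def leg_pair_def mem_legs pp)
qed

lemma TZ_coord_trapezium: "TZ_coord = {p \<in> trapezium. fst p < 1} - (top_leg \<union> bot_leg)"
  by (auto simp: TZ_coord_def trapezium_def top_leg_def bot_leg_def image_iff)

lemma val_trapezium:
  assumes "w \<in> digit_words"
  obtains p where "p \<in> trapezium" "val w = pt p"
proof -
  have "val w \<in> pt ` trapezium"
  proof (rule val_in[OF compact_imp_closed[OF compact_trapezium] _ _ assms])
    have "(0, 0) \<in> trapezium" by (simp add: trapezium_def)
    then show "pt ` trapezium \<noteq> {}" by blast
    fix m y assume "m \<in> digits" "y \<in> pt ` trapezium"
    then show "contr m y \<in> pt ` trapezium" using contr_pt contr_coord_trapezium(1) by auto
  qed
  then show ?thesis using that by blast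
qed

text \<open>
  Finite prefixes of the word, applied to a point of the leg that belongs to the next letter, give points
  of the leg that belongs to the first letter; the value is their limit.
\<close>

lemma val_leg:
  assumes "w \<in> digit_words" "\<And>i. leg_pair (w i) (w (Suc i))"
  shows "val w \<in> pt ` leg (w 0)"
proof -
  define z where "z n = pt (if w n \<in> {2, 5} then (0, 1) else (0, 0))" for n
  have "norm (pt (0, 1)) = 1" "norm (pt (0, 0)) = 0"
    by (simp_all add: pt_altdef norm_inverse)
  then have "norm (z n) \<le> 1" for n by (auto simp: z_def)
  then have lim: "(\<lambda>n. word_map w n (z n)) \<longlonglongrightarrow> val w" by (rule word_map_tendsto)
  have mem: "word_map v n x \<in> pt ` leg (v 0)"
    if "v \<in> digit_words" "\<And>i. leg_pair (v i) (v (Suc i))" "x \<in> pt ` leg (v n)" for v n x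
    using that
  proof (induction n arbitrary: v)
    case (Suc n)
    have "word_map (\<lambda>i. v (Suc i)) n x \<in> pt ` leg (v (Suc 0))"
      using Suc.IH[of "\<lambda>i. v (Suc i)"] Suc.prems by (simp add: digit_words_def)
    then obtain p where "p \<in> leg (v (Suc 0))" "word_map (\<lambda>i. v (Suc i)) n x = pt p" by blast
    then show ?case
      using contr_coord_leg[OF Suc.prems(2)[of 0]] contr_pt[of "v 0" p] Suc.prems(1) by (auto simp: digit_words_def)
  qed simp
  have "z n \<in> pt ` leg (w n)" for n
    unfolding z_def leg_def top_leg_def bot_leg_def by force
  then have "\<forall>n. word_map w n (z n) \<in> pt ` leg (w 0)" using mem assms by blast
  then show ?thesis using lim closed_leg by (metis closed_sequentially)
qed

definition aper_coord_words :: "(nat \<Rightarrow> nat) set" where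
  "aper_coord_words = {w \<in> digit_words. \<exists>\<^sub>\<infinity>i. \<not> leg_pair (w i) (w (Suc i))}"

text \<open>
  For the first inclusion, the tails of an address constructed by desubstitution have aperiodic values,
  which avoid the legs, so that no tail follows the allowed pairs for ever. For the second one, a tail
  with its value on a leg forces the word to follow the allowed pairs from there on, so all tails have
  values in \<open>TZ_coord\<close>.
\<close>

lemma pt_aper_coord_val: "pt ` aper_coord = val ` aper_coord_words"
proof (intro equalityI subsetI)
  fix x assume "x \<in> pt ` aper_coord"
  have "bounded (pt ` aper_coord)"
  proof -
    have "aper_coord \<subseteq> trapezium" using TZ_coord_trapezium by (auto simp: aper_coord_def)
    moreover have "bounded (pt ` trapezium)"
      using compact_trapezium by (rule compact_imp_bounded)
    ultimately show ?thesis by (meson bounded_subset image_mono)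
  qed
  moreover have "pt ` aper_coord \<subseteq> (\<Union>m\<in>digits. contr m ` pt ` aper_coord)"
  proof (rule image_subsetI)
    fix p assume "p \<in> aper_coord"
    then obtain m q where "m \<in> digits" "q \<in> aper_coord" "p = contr_coord m q" by (subst (asm) aper_coord_eq) blast
    then show "pt p \<in> (\<Union>m\<in>digits. contr m ` pt ` aper_coord)" using contr_pt by (metis UN_I imageI)
  qed
  ultimately obtain w where w: "w \<in> digit_words" "val w = x" "\<And>n. val (\<lambda>i. w (n + i)) \<in> pt ` aper_coord"
    using \<open>x \<in> pt ` aper_coord\<close> by (rule val_addressing) (rule that)
  have "\<exists>\<^sub>\<infinity>i. \<not> leg_pair (w i) (w (Suc i))"
  proof (rule ccontr)
    assume "\<not> ?thesis"
    then obtain n where n: "\<And>i. i \<ge> n \<Longrightarrow> leg_pair (w i) (w (Suc i))"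
      by (auto simp: INFM_nat_le)
    have "val (\<lambda>i. w (n + i)) \<in> pt ` leg (w (n + 0))"
      by (rule val_leg) (use w n in \<open>auto simp: digit_words_def\<close>)
    then obtain p where "p \<in> leg (w n)" "p \<in> aper_coord" using w(3)[of n] by (auto simp: image_iff)
    then show False by (auto simp: aper_coord_def TZ_coord_trapezium leg_def split: if_splits)
  qed
  then show "x \<in> val ` aper_coord_words" using w by (auto simp: aper_coord_words_def)
next
  fix x assume "x \<in> val ` aper_coord_words"
  then obtain w where w: "w \<in> digit_words" "\<exists>\<^sub>\<infinity>i. \<not> leg_pair (w i) (w (Suc i))" "x = val w"
    by (auto simp: aper_coord_words_def)
  have "\<exists>p. p \<in> trapezium \<and> val (\<lambda>i. w (n + i)) = pt p" for n
  proof -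
    have "(\<lambda>i. w (n + i)) \<in> digit_words" using w by (simp add: digit_words_def)
    then show ?thesis by (rule val_trapezium) blast
  qed
  then obtain y where y: "\<And>n. y n \<in> trapezium" "\<And>n. val (\<lambda>i. w (n + i)) = pt (y n)" by metis
  have dig: "w n \<in> digits" for n using w by (simp add: digit_words_def)
  have step: "y n = contr_coord (w n) (y (Suc n))" for n
  proof -
    have "pt (y n) = contr (w n) (pt (y (Suc n)))"
      unfolding y(2)[symmetric] by (subst val_step) simp
    then show ?thesis using contr_pt[OF dig] by simp
  qed
  have next_leg: "leg_pair (w n) (w (Suc n)) \<and> y (Suc n) \<in> top_leg \<union> bot_leg"
    if "y n \<in> top_leg \<union> bot_leg" for n
  proof -
    have *: "y (Suc n) = contr_coord (w (Suc n)) (y (Suc (Suc n)))" by (rule step)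
    have "w n = 5 \<and> y (Suc n) \<in> top_leg \<or> w n = 2 \<and> y (Suc n) \<in> bot_leg \<or>
        w n = 0 \<and> y (Suc n) \<in> bot_leg \<or> w n = 3 \<and> y (Suc n) \<in> top_leg"
      using that step[of n] contr_coord_in_leg[OF y(1)[of "Suc n"] dig[of n]] by (auto simp del: split_paired_All)
    moreover have "w (Suc n) \<in> {2, 5}" if "y (Suc n) \<in> top_leg"
      using that * contr_coord_in_leg(1)[OF y(1)[of "Suc (Suc n)"] dig[of "Suc n"]] by auto
    moreover have "w (Suc n) \<in> {0, 3}" if "y (Suc n) \<in> bot_leg"
      using that * contr_coord_in_leg(2)[OF y(1)[of "Suc (Suc n)"] dig[of "Suc n"]] by auto
    ultimately show ?thesis by (auto simp: leg_pair_def)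
  qed
  have not_leg: "y n \<notin> top_leg \<union> bot_leg" for n
  proof
    assume n: "y n \<in> top_leg \<union> bot_leg"
    have "y i \<in> top_leg \<union> bot_leg" if "i \<ge> n" for i
      using that by (induction i rule: dec_induct) (use n next_leg in blast)+
    then have "\<forall>i\<ge>n. leg_pair (w i) (w (Suc i))" using next_leg by blast
    then show False using w(2) by (auto simp: INFM_nat_le)
  qed
  have TZ_coord: "y n \<in> TZ_coord" for n
    using not_leg[of n] y(1)[of n] step[of n] contr_coord_trapezium(2)[OF y(1)[of "Suc n"] dig[of n]] by (auto simp: TZ_coord_trapezium)
  have "infinite (orb ret_map (y 0))"
    by (rule infinite_orb_of_depth[of "range y"]) (use TZ_coord step dig in blast)+
  then have "y 0 \<in> aper_coord" using TZ_coord by (simp add: aper_coord_def)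
  then show "x \<in> pt ` aper_coord" using w(3) y(2)[of 0] by simp
qed

lemma val_close:
  assumes "\<And>i. i < n \<Longrightarrow> v i = w i"
  shows "dist (val v) (val w) \<le> (1 - lam) ^ n * 4"
proof -
  have eq: "word_map v n z = word_map w n z" for z
    using assms
  proof (induction n arbitrary: v w)
    case (Suc n)
    have "word_map (\<lambda>i. v (Suc i)) n z = word_map (\<lambda>i. w (Suc i)) n z"
      by (rule Suc.IH) (rule Suc.prems, simp)
    then show ?case using Suc.prems[of 0] by simp
  qed simp
  have "dist (val v) (val w) = dist (word_map w n (val (\<lambda>i. v (n + i)))) (word_map w n (val (\<lambda>i. w (n + i))))"
    by (rule arg_cong2[where f = dist]) (rule val_word_map[of v n, unfolded eq] val_word_map[of w n])+
  also have "\<dots> = (1 - lam) ^ n * dist (val (\<lambda>i. v (n + i))) (val (\<lambda>i. w (n + i)))"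
    by (rule dist_word_map)
  also have "dist (val (\<lambda>i. v (n + i))) (val (\<lambda>i. w (n + i))) \<le> 4"
    using norm_val[of "\<lambda>i. v (n + i)"] norm_val[of "\<lambda>i. w (n + i)"]
      norm_triangle_ineq4[of "val (\<lambda>i. v (n + i))" "val (\<lambda>i. w (n + i))"]
    by (simp add: dist_norm)
  finally show ?thesis using lam_powers by (simp add: mult_left_mono)
qed

lemma aper_coord_dense: "attractor \<subseteq> closure (pt ` aper_coord)"
proof
  fix x assume "x \<in> attractor"
  then obtain w where w: "w \<in> digit_words" "x = val w" by (auto simp: attractor_val)
  \<comment> \<open>Continuing by threes gives infinitely many pairs \<open>33\<close>, which is not allowed on a leg.\<close>
  define v where "v n = (\<lambda>i. if i < n then w i else 3)" for n :: nat
  have "v n \<in> aper_coord_words" for n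
  proof -
    have "\<exists>i>m. \<not> leg_pair (v n i) (v n (Suc i))" for m
      by (intro exI[of _ "Suc (m + n)"]) (simp add: v_def leg_pair_def)
    then show ?thesis using w by (auto simp: aper_coord_words_def digit_words_def v_def INFM_nat digits_def)
  qed
  then have "\<forall>n. val (v n) \<in> pt ` aper_coord" using pt_aper_coord_val by blast
  moreover have "(\<lambda>n. val (v n)) \<longlonglongrightarrow> x"
  proof (rule metric_tendsto_imp_tendsto[OF lam_pow_tendsto[of 4]])
    have "dist (val (v n)) x \<le> (1 - lam) ^ n * 4" for n
      unfolding w(2) by (rule val_close) (simp add: v_def)
    then show "\<forall>\<^sub>F n in sequentially. dist (val (v n)) x \<le> dist ((1 - lam) ^ n * 4) 0"
      by (intro always_eventually allI) (simp add: order_trans[OF _ abs_ge_self])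
  qed
  ultimately show "x \<in> closure (pt ` aper_coord)"
    unfolding closure_sequential by (intro exI[of _ "\<lambda>n. val (v n)"] conjI)
qed

lemma aper_coord_proper: "pt ` aper_coord \<subset> attractor"
proof
  show "pt ` aper_coord \<subseteq> attractor" by (auto simp: pt_aper_coord_val attractor_val aper_coord_words_def)
  have "val (\<lambda>_. 0) = 0"
  proof (rule val_eqI)
    have "nested (\<lambda>_. 0) n = 0" for n by (induction n) (simp_all add: d_shift_def)
    then have "nested (\<lambda>_. 0) = (\<lambda>_. 0)" by (rule ext)
    then show "nested (\<lambda>_. 0) \<longlonglongrightarrow> 0" by simp
  qed
  moreover have "(\<lambda>_. 0) \<in> digit_words" by (simp add: digit_words_def digits_def)
  ultimately have "0 \<in> attractor" unfolding attractor_val by (metis imageI)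
  moreover have "0 \<notin> pt ` aper_coord"
  proof -
    have "0 = pt (0, 0)" by (simp add: pt_altdef)
    moreover have "(0, 0) \<notin> aper_coord" by (simp add: aper_coord_def TZ_coord_def)
    ultimately show ?thesis by (metis imageE pt_eq_iff)
  qed
  ultimately show "pt ` aper_coord \<noteq> attractor" by blast
qed

section \<open>Bounded lattice points\<close>

text \<open>
  An automaton with arbitrary finite state type can be relabelled by natural numbers.
\<close>

lemma buchi_recognizableI:
  fixes Q :: "'q set"
  assumes "finite Q" "finite \<Sigma>" "I \<subseteq> Q" "F \<subseteq> Q" "E \<subseteq> Q \<times> \<Sigma> \<times> Q"
    and W: "\<And>w. w \<in> W \<longleftrightarrow>
      (\<exists>r. r 0 \<in> I \<and> (\<forall>i. (r i, w i, r (Suc i)) \<in> E) \<and> (\<exists>\<^sub>\<infinity>i. r i \<in> F))"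
  shows "buchi_recognizable \<Sigma> W"
proof -
  obtain f :: "'q \<Rightarrow> nat" where inj: "inj_on f Q"
    using finite_imp_inj_to_nat_seg[OF assms(1)] by blast
  define A where "A = \<lparr>states = f ` Q, alphabet = \<Sigma>, initials = f ` I, finals = f ` F,
    edges = (\<lambda>(p, a, q). (f p, a, f q)) ` E\<rparr>"
  have "buchi_automaton A"
    using assms by (auto simp: buchi_automaton_def A_def)
  moreover have "buchi_language A = W"
  proof (intro equalityI subsetI)
    fix w assume "w \<in> buchi_language A"
    then obtain r where r: "r 0 \<in> f ` I" "\<And>i. (r i, w i, r (Suc i)) \<in> edges A" "\<exists>\<^sub>\<infinity>i. r i \<in> f ` F"
      by (auto simp: buchi_language_def is_run_def A_def)
    define g where "g = inv_into Q f"
    have g: "g (f q) = q" if "q \<in> Q" for q using inj that by (simp add: g_def)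
    have "(g (r i), w i, g (r (Suc i))) \<in> E" for i
    proof -
      obtain p q where "(p, w i, q) \<in> E" "r i = f p" "r (Suc i) = f q"
        using r(2)[of i] by (auto simp: A_def)
      moreover then have "p \<in> Q" "q \<in> Q" using assms(5) by auto
      ultimately show ?thesis using g by simp
    qed
    moreover have "g (r 0) \<in> I" using r(1) g assms(3) by auto
    moreover have "\<exists>\<^sub>\<infinity>i. g (r i) \<in> F" using r(3) by (rule INFM_mono) (use g assms(4) in auto)
    ultimately show "w \<in> W" using W by (intro W[THEN iffD2] exI[of _ "\<lambda>i. g (r i)"] conjI allI)
  next
    fix w assume "w \<in> W"
    then obtain r where r: "r 0 \<in> I" "\<And>i. (r i, w i, r (Suc i)) \<in> E" "\<exists>\<^sub>\<infinity>i. r i \<in> F"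
      using W by blast
    have "\<exists>\<^sub>\<infinity>i. f (r i) \<in> f ` F" using r(3) by (rule INFM_mono) auto
    moreover have "(f (r i), w i, f (r (Suc i))) \<in> edges A" for i
      using r(2)[of i] by (force simp: A_def)
    ultimately show "w \<in> buchi_language A"
      using r(1) unfolding buchi_language_def is_run_def
      by (auto simp: A_def intro!: exI[of _ "\<lambda>i. f (r i)"])
  qed
  ultimately show ?thesis
    unfolding buchi_recognizable_def by (intro exI[of _ A]) (simp add: A_def)
qed

abbreviation "u1 \<equiv> inverse zeta"
abbreviation "u2 \<equiv> inverse (zeta ^ 2)"
abbreviation "l1 \<equiv> complex_of_real lam"
abbreviation "l2 \<equiv> complex_of_real (- omega)"

text \<open>
  With \<open>l = zeta + 1 / zeta\<close> and \<open>u = 1 / zeta\<close> this is the general element of \<open>\<int>[zeta]\<close>; replacing \<open>zeta\<close>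
  by \<open>zeta^2\<close>, that is \<open>l1\<close> and \<open>u1\<close> by \<open>l2\<close> and \<open>u2\<close>, gives its Galois conjugate.
\<close>

definition lat :: "complex \<Rightarrow> complex \<Rightarrow> int \<Rightarrow> int \<Rightarrow> int \<Rightarrow> int \<Rightarrow> complex" where
  "lat l u a b c e = (of_int a + of_int b * l) - (of_int c + of_int e * l) * u"

lemma u1_eq: "u1 * u1 = l1 * u1 - 1"
  by (rule inverse_zeta_sq)

lemma l1_eq: "l1 * l1 = 1 - l1"
  by (metis lam_sq of_real_1 of_real_diff of_real_mult)

lemma l2_eq: "l2 * l2 = 1 - l2"
proof -
  have "(- omega) * (- omega) = 1 - (- omega)" by (simp add: omega_lam algebra_simps lam_red)
  then show ?thesis by (metis of_real_1 of_real_diff of_real_mult)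
qed

lemma l2_l1: "l2 = - 1 - l1"
  by (simp add: omega_lam)

lemma u2_u1: "u2 = u1 * u1"
  by (simp add: power2_eq_square)

lemma u2_eq: "u2 * u2 = l2 * u2 - 1"
proof -
  have 3: "u1 * (u1 * x) = l1 * (u1 * x) - x" for x
    using u1_eq by (metis left_diff_distrib mult.assoc mult_1)
  have l: "l1 * (l1 * x) = x - l1 * x" for x
    using l1_eq by (metis left_diff_distrib mult.assoc mult_1)
  show ?thesis unfolding u2_u1 l2_l1 by (simp add: algebra_simps u1_eq 3 l1_eq l)
qed

text \<open>
  The elements of \<open>\<int>[zeta]\<close> paired with their conjugates; the two components embed the ring as a lattice.
\<close>

definition lattice_pairs :: "(complex \<times> complex) set" where
  "lattice_pairs = {(lat l1 u1 a b c e, lat l2 u2 a b c e) | a b c e. True}"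

lemma lattice_diff:
  assumes "(x, x') \<in> lattice_pairs" "(y, y') \<in> lattice_pairs"
  shows "(x - y, x' - y') \<in> lattice_pairs"
proof -
  have "lat l u a b c e - lat l u a' b' c' e' = lat l u (a - a') (b - b') (c - c') (e - e')" for l u a b c e a' b' c' e'
    by (simp add: lat_def algebra_simps)
  then show ?thesis using assms unfolding lattice_pairs_def by fastforce
qed

lemma lattice_zero: "(0, 0) \<in> lattice_pairs"
proof -
  have "lat l u 0 0 0 0 = 0" for l u by (simp add: lat_def)
  then show ?thesis unfolding lattice_pairs_def by force
qed

lemma lattice_add:
  assumes "(x, x') \<in> lattice_pairs" "(y, y') \<in> lattice_pairs"
  shows "(x + y, x' + y') \<in> lattice_pairs"
  using lattice_diff[OF assms(1) lattice_diff[OF lattice_zero assms(2)]] by simp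

lemma lattice_mult_u:
  assumes "(x, x') \<in> lattice_pairs"
  shows "(u1 * x, u2 * x') \<in> lattice_pairs"
proof -
  have *: "u * lat l u a b c e = lat l u c e (e - a) (c - e - b)" if u: "u * u = l * u - 1" and l: "l * l = 1 - l" for l u a b c e
  proof -
    have uu: "u * (u * x) = l * (u * x) - x" for x using u by (metis left_diff_distrib mult.assoc mult_1)
    have ll: "l * (l * x) = x - l * x" for x using l by (metis left_diff_distrib mult.assoc mult_1)
    show ?thesis by (simp add: lat_def algebra_simps u uu l ll)
  qed
  show ?thesis using assms *[OF u1_eq l1_eq] *[OF u2_eq l2_eq] unfolding lattice_pairs_def by fastforce
qed

lemma lattice_mult_l:
  assumes "(x, x') \<in> lattice_pairs"
  shows "(l1 * x, l2 * x') \<in> lattice_pairs"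
proof -
  have *: "l * lat l u a b c e = lat l u b (a - b) e (c - e)" if l: "l * l = 1 - l" for l u a b c e
  proof -
    have ll: "l * (l * x) = x - l * x" for x using l by (metis left_diff_distrib mult.assoc mult_1)
    show ?thesis by (simp add: lat_def algebra_simps l ll)
  qed
  show ?thesis using assms *[OF l1_eq] *[OF l2_eq] unfolding lattice_pairs_def by fastforce
qed

lemma lattice_mult_u_power:
  assumes "(x, x') \<in> lattice_pairs"
  shows "(u1 ^ n * x, u2 ^ n * x') \<in> lattice_pairs"
proof (induction n)
  case (Suc n)
  show ?case using lattice_mult_u[OF Suc] by (simp add: mult.assoc)
qed (use assms in simp)

text \<open>
  The conjugate of the expanding factor \<open>omega^2\<close> is the contracting factor \<open>1 / omega^2 = 1 - lam\<close>.
\<close>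

lemma lattice_mult_omega_sq:
  assumes "(x, x') \<in> lattice_pairs"
  shows "(of_real (omega ^ 2) * x, of_real ((1 - lam)) * x') \<in> lattice_pairs"
proof -
  have "of_real (omega ^ 2) * x = x + x + l1 * x" "of_real (1 - lam) * x' = x' + x' + l2 * x'"
    using lam_sq by (simp_all add: omega_lam power2_eq_square algebra_simps flip: of_real_mult)
  then show ?thesis using lattice_add[OF lattice_add[OF assms assms] lattice_mult_l[OF assms]] by simp
qed

definition d_conj :: "nat \<Rightarrow> complex" where
  "d_conj m = (if m = 2 then zeta ^ 2
          else if m = 3 then - of_real omega * zeta ^ 2
          else if m = 5 then of_real omega * u2
          else 0)"

lemma lattice_d_shift: "(d_shift m, d_conj m) \<in> lattice_pairs"
proof -
  have z: "(zeta, zeta ^ 2) \<in> lattice_pairs"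
  proof -
    have "zeta = lat l1 u1 0 1 1 0" by (simp add: lat_def zeta_via_inverse[symmetric])
    moreover have "zeta ^ 2 = lat l2 u2 0 1 1 0"
    proof -
      have "u2 = (zeta ^ 2 * u2) * u2" by simp
      also have "\<dots> = zeta ^ 2 * (l2 * u2 - 1)" by (simp only: mult.assoc u2_eq)
      also have "\<dots> = l2 - zeta ^ 2" by (simp add: algebra_simps)
      finally have "u2 = l2 - zeta ^ 2" .
      then show ?thesis by (simp add: lat_def)
    qed
    ultimately show ?thesis unfolding lattice_pairs_def by blast
  qed
  have one: "(1, 1) \<in> lattice_pairs"
  proof -
    have "lat l u 1 0 0 0 = 1" for l u by (simp add: lat_def)
    then show ?thesis unfolding lattice_pairs_def by force
  qed
  have om: "1 / complex_of_real omega = l1"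
    using omega_times_lam omega_pos by (simp add: field_simps flip: of_real_mult)
  have 3: "(zeta / of_real omega, - of_real omega * zeta ^ 2) \<in> lattice_pairs"
    using lattice_mult_l[OF z] om by (simp add: divide_inverse mult.commute)
  have 5: "(- (1 / (of_real omega * zeta)), of_real omega * u2) \<in> lattice_pairs"
    using lattice_diff[OF lattice_zero lattice_mult_l[OF lattice_mult_u[OF one]]] om by (simp add: divide_inverse)
  show ?thesis using z 3 5 lattice_zero by (simp add: d_shift_def d_conj_def)
qed

lemma norm_u [simp]: "norm u1 = 1" "norm u2 = 1"
  by (simp_all add: norm_inverse norm_power)

lemma norm_d_conj: "norm (d_conj m) \<le> omega"
  using omega_pos by (simp add: d_conj_def norm_mult norm_power norm_inverse)

lemma Im_u2: "Im u2 = - (lam * Im zeta)"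
proof -
  have "Im u2 = Im (l1 * u1 - 1)" unfolding u2_u1 u1_eq ..
  then show ?thesis by (simp add: inverse_zeta)
qed

text \<open>
  Bounds on an element and on its conjugate bound first the imaginary and then the real parts, hence
  the numbers \<open>a + b * lam\<close>, \<open>a - b * omega\<close>, \<open>c + e * lam\<close>, \<open>c - e * omega\<close>, and finally the four integers.
\<close>

lemma finite_lattice_bounded: "finite {(x, y) \<in> lattice_pairs. norm x \<le> 4 \<and> norm y \<le> 2}"
proof -
  let ?B = "{-40..40} :: int set"
  have bound: "a \<in> ?B \<and> b \<in> ?B \<and> c \<in> ?B \<and> e \<in> ?B"
    if n1: "norm (lat l1 u1 a b c e) \<le> 4" and n2: "norm (lat l2 u2 a b c e) \<le> 2" for a b c e
  proof -
    have real_part: "\<bar>A\<bar> \<le> K + \<bar>C\<bar>" if "norm (of_real A - of_real C * u) \<le> K" "norm u = 1" for A C K and u :: complex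
    proof -
      have "norm (complex_of_real A) \<le> norm (of_real A - of_real C * u) + norm (of_real C * u)"
        using norm_triangle_ineq[of "of_real A - of_real C * u" "of_real C * u"] by simp
      then show ?thesis using that by (simp add: norm_mult)
    qed
    have im_part: "\<bar>C\<bar> * \<bar>Im u\<bar> \<le> K" if "norm (of_real A - of_real C * u) \<le> K" for A C K and u :: complex
    proof -
      have "\<bar>Im (of_real A - of_real C * u)\<bar> \<le> K" using that abs_Im_le_cmod order_trans by blast
      then show ?thesis by (simp add: abs_mult)
    qed
    define A C A' C' where ac: "A = of_int a + of_int b * lam" "C = of_int c + of_int e * lam"
      "A' = of_int a - of_int b * omega" "C' = of_int c - of_int e * omega"
    have n1': "norm (of_real A - of_real C * u1) \<le> 4" and n2': "norm (of_real A' - of_real C' * u2) \<le> 2"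
      using n1 n2 by (simp_all add: lat_def ac)
    have "\<bar>C\<bar> * (1 / 2) \<le> \<bar>C\<bar> * \<bar>Im u1\<bar>"
      by (rule mult_left_mono) (use Im_zeta in \<open>simp_all only: Im_inverse_zeta abs_minus_cancel abs_ge_zero\<close>)
    then have C: "\<bar>C\<bar> \<le> 8" using im_part[OF n1'] by linarith
    have "(3 / 5) * (1 / 2) \<le> lam * Im zeta" using lam_bounds Im_zeta by (intro mult_mono) auto
    then have "3 / 10 \<le> \<bar>Im u2\<bar>" unfolding Im_u2 by simp
    then have "\<bar>C'\<bar> * (3 / 10) \<le> \<bar>C'\<bar> * \<bar>Im u2\<bar>"
      by (rule mult_left_mono) (rule abs_ge_zero)
    then have C': "\<bar>C'\<bar> \<le> 7" using im_part[OF n2'] by linarith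
    have A: "\<bar>A\<bar> \<le> 12" "\<bar>A'\<bar> \<le> 9" using real_part[OF n1'] real_part[OF n2'] C C' by auto
    have coeff: "\<bar>real_of_int e\<bar> \<le> (X + X') / 2 \<and> \<bar>real_of_int c\<bar> \<le> X + (X + X') / 2"
      if "\<bar>of_int c + of_int e * lam\<bar> \<le> X" "\<bar>of_int c - of_int e * omega\<bar> \<le> X'" for c e X X'
    proof -
      have "of_int e * (lam + omega) = (of_int c + of_int e * lam) - (of_int c - of_int e * omega)"
        by (simp add: algebra_simps)
      then have "\<bar>real_of_int e\<bar> * (lam + omega) \<le> X + X'"
        using that lam_bounds omega_pos by (simp add: abs_mult[symmetric] flip: abs_of_pos)
      moreover have "\<bar>real_of_int e\<bar> * 2 \<le> \<bar>real_of_int e\<bar> * (lam + omega)"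
        using lam_bounds by (intro mult_left_mono) (auto simp: omega_lam)
      ultimately have "\<bar>real_of_int e\<bar> * 2 \<le> X + X'" by (rule order_trans[rotated])
      then have e: "\<bar>real_of_int e\<bar> \<le> (X + X') / 2" by simp
      moreover have "\<bar>of_int e * lam\<bar> \<le> \<bar>real_of_int e\<bar> * 1"
        using lam_bounds unfolding abs_mult by (intro mult_left_mono) auto
      ultimately show ?thesis using that(1) by linarith
    qed
    show ?thesis
      using coeff[of c e 8 7] coeff[of a b 12 9] C C' A unfolding ac by auto
  qed
  have "{(x, y) \<in> lattice_pairs. norm x \<le> 4 \<and> norm y \<le> 2}
      \<subseteq> (\<lambda>(a, b, c, e). (lat l1 u1 a b c e, lat l2 u2 a b c e)) ` (?B \<times> ?B \<times> ?B \<times> ?B)"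
  proof
    fix z assume "z \<in> {(x, y) \<in> lattice_pairs. norm x \<le> 4 \<and> norm y \<le> 2}"
    then obtain a b c e where z: "z = (lat l1 u1 a b c e, lat l2 u2 a b c e)"
        "norm (lat l1 u1 a b c e) \<le> 4" "norm (lat l2 u2 a b c e) \<le> 2"
      unfolding lattice_pairs_def by blast
    then show "z \<in> (\<lambda>(a, b, c, e). (lat l1 u1 a b c e, lat l2 u2 a b c e)) ` (?B \<times> ?B \<times> ?B \<times> ?B)"
      using bound[OF z(2,3)] by (intro image_eqI[where x = "(a, b, c, e)"]) simp_all
  qed
  then show ?thesis by (rule finite_subset) auto
qed

section \<open>The automaton\<close>

lemma u1_pow5: "u1 ^ 5 = 1" and u2_pow5: "u2 ^ 5 = 1"
proof -
  have "zeta ^ 10 = (zeta ^ 5) ^ 2" by (simp flip: power_mult)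
  then show "u1 ^ 5 = 1" "u2 ^ 5 = 1" using zeta_pow5 by (simp_all add: power_inverse flip: power_mult)
qed

lemma power_mod_5: "x ^ 5 = 1 \<Longrightarrow> x ^ (n mod 5) = x ^ n" for x :: complex
  by (metis mod_mult_div_eq mult_1_right power_add power_mult power_one)

lemma u1_pow4: "u1 ^ (4 * m) = zeta ^ m"
proof -
  have "zeta * zeta ^ 4 = 1" using zeta_pow5 by (simp add: eval_nat_numeral)
  then have "u1 ^ 4 = zeta" by (metis inverse_unique power_inverse mult.commute)
  then show ?thesis by (simp add: power_mult)
qed

lemma contr_alt: "contr m x = of_real (1 - lam) * (zeta ^ m * x) + d_shift m"
proof -
  have "contr m x = of_real (1 / omega ^ 2) * (zeta ^ m * x) + d_shift m"
    by (simp add: contr_def)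
  then show ?thesis by (simp only: inverse_omega_sq)
qed

lemma omega_sq_cancel: "complex_of_real (omega ^ 2) * of_real (1 - lam) = 1"
proof -
  have "omega ^ 2 * (1 - lam) = 1" using inverse_omega_sq omega_pos by (simp add: field_simps)
  then show ?thesis by (metis of_real_1 of_real_mult)
qed

text \<open>
  The triple \<open>(k, b, b')\<close> stands for the isometry \<open>y \<mapsto> y / zeta^k + b\<close>; the component \<open>b'\<close> is the conjugate
  of \<open>b\<close>, which is carried along to see that \<open>b\<close> takes only finitely many values.
\<close>

type_synonym offset = "nat \<times> complex \<times> complex"

fun place :: "offset \<Rightarrow> complex \<Rightarrow> complex" where
  "place (k, b, b') y = u1 ^ k * y + b"

fun next_offset :: "nat \<Rightarrow> nat \<Rightarrow> offset \<Rightarrow> offset" where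
  "next_offset m m' (k, b, b') =
     ((k + 4 * m + m') mod 5,
      of_real (omega ^ 2) * (u1 ^ m' * (u1 ^ k * d_shift m + b - d_shift m')),
      of_real (1 - lam) * (u2 ^ m' * (u2 ^ k * d_conj m + b' - d_conj m')))"

declare next_offset.simps [simp del]

text \<open>
  The recursion for offsets solves this equation. Since contractions by the same factor are compared, the
  linear part of the solution is again a power of \<open>zeta\<close>.
\<close>

lemma contr_place_next: "contr m' (place (next_offset m m' x) y) = place x (contr m y)"
proof (cases x)
  case [simp]: (fields k b b')
  have "u1 ^ ((k + 4 * m + m') mod 5) = u1 ^ k * zeta ^ m * u1 ^ m'"
    unfolding power_mod_5[OF u1_pow5] power_add u1_pow4 ..
  then have p: "place (next_offset m m' x) y
      = u1 ^ m' * (u1 ^ k * zeta ^ m * y + of_real (omega ^ 2) * (u1 ^ k * d_shift m + b - d_shift m'))"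
    by (simp add: next_offset.simps algebra_simps)
  have z: "zeta ^ m' * (u1 ^ m' * c) = c" for c
    by (simp add: power_inverse mult.assoc[symmetric])
  have o: "of_real (1 - lam) * (complex_of_real (omega ^ 2) * c) = c" for c
    using omega_sq_cancel by (metis mult.assoc mult.commute mult_1)
  have "contr m' (place (next_offset m m' x) y)
      = of_real (1 - lam) * (u1 ^ k * zeta ^ m * y)
        + of_real (1 - lam) * (of_real (omega ^ 2) * (u1 ^ k * d_shift m + b - d_shift m')) + d_shift m'"
    unfolding contr_alt p z by (simp add: distrib_left)
  also have "\<dots> = place x (contr m y)"
    unfolding o by (simp add: contr_alt algebra_simps)
  finally show ?thesis .
qed

definition offsets :: "offset set" where
  "offsets = {..<5} \<times> {(b, b') \<in> lattice_pairs. norm b \<le> 4 \<and> norm b' \<le> 2}"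

lemma finite_offsets: "finite offsets"
  unfolding offsets_def using finite_lattice_bounded by blast

text \<open>
  The conjugate component is contracted by \<open>1 - lam\<close> in each step, and the bound \<open>2\<close> is the
  fixed point of the resulting estimate.
\<close>

lemma next_offset_in:
  assumes "x \<in> offsets" and v: "place (next_offset m m' x) y = y'" "norm y \<le> 2" "norm y' \<le> 2"
  shows "next_offset m m' x \<in> offsets"
proof -
  obtain k b b' where x: "x = (k, b, b')" by (cases x)
  then have mem: "(b, b') \<in> lattice_pairs" "norm b' \<le> 2" using assms(1) by (auto simp: offsets_def)
  obtain k' c c' where n: "next_offset m m' x = (k', c, c')" by (cases "next_offset m m' x")
  then have c: "k' = (k + 4 * m + m') mod 5"
      "c = of_real (omega ^ 2) * (u1 ^ m' * (u1 ^ k * d_shift m + b - d_shift m'))"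
      "c' = of_real (1 - lam) * (u2 ^ m' * (u2 ^ k * d_conj m + b' - d_conj m'))"
    by (simp_all add: x next_offset.simps)
  have "(c, c') \<in> lattice_pairs"
    unfolding c
    by (intro lattice_mult_omega_sq lattice_mult_u_power lattice_diff lattice_add lattice_d_shift mem)
  moreover have "norm c \<le> 4"
  proof -
    have "c = y' - u1 ^ k' * y" using v(1) n by (auto simp: eq_diff_eq add.commute)
    then have "norm c \<le> norm y' + norm (u1 ^ k' * y)" using norm_triangle_ineq4 by simp
    also have "norm (u1 ^ k' * y) = norm y" by (simp add: norm_mult norm_power)
    finally show ?thesis using v by simp
  qed
  moreover have "norm c' \<le> 2"
  proof -
    have "norm (u2 ^ k * d_conj m + b' - d_conj m') \<le> norm (u2 ^ k * d_conj m) + norm b' + norm (d_conj m')"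
      by (intro order_trans[OF norm_triangle_ineq4] add_right_mono norm_triangle_ineq)
    also have "norm (u2 ^ k * d_conj m) = norm (d_conj m)" by (simp only: norm_mult norm_power norm_u power_one mult_1)
    finally have "norm (u2 ^ k * d_conj m + b' - d_conj m') \<le> 2 * omega + 2"
      using norm_d_conj[of m] norm_d_conj[of m'] mem(2) by linarith
    then have "norm c' \<le> (1 - lam) * (2 * omega + 2)"
      unfolding c using lam_powers
      by (simp add: norm_mult norm_power mult_left_mono del: of_real_diff power_inverse inverse_eq_divide)
    also have "\<dots> = 2" by (simp add: omega_lam algebra_simps lam_red)
    finally show ?thesis .
  qed
  ultimately show ?thesis by (simp add: n offsets_def c(1))
qed

lemma val_eq_of_offsets:
  assumes "x 0 = (0, 0, 0)" "\<And>i. x (Suc i) = next_offset (w i) (v i) (x i)" "\<And>i. x i \<in> offsets"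
  shows "val w = val v"
proof -
  have inv: "word_map w n y = word_map v n (place (x n) y)" for n y
  proof (induction n arbitrary: y)
    case (Suc n)
    then show ?case unfolding word_map_Suc_right assms(2) contr_place_next by simp
  qed (simp add: assms(1))
  have "(\<lambda>n. word_map v n (place (x n) 0)) \<longlonglongrightarrow> val v"
  proof (rule word_map_tendsto)
    show "norm (place (x n) 0) \<le> 4" for n
      using assms(3)[of n] by (cases "x n") (auto simp: offsets_def)
  qed
  moreover have "(\<lambda>n. word_map w n 0) \<longlonglongrightarrow> val w"
    by (rule word_map_tendsto) (rule order_refl)
  ultimately show ?thesis unfolding inv using LIMSEQ_unique by blast
qed

lemma offsets_of_val_eq:
  assumes "val w = val v"
  obtains x where "x 0 = (0, 0, 0)" "\<And>i. x (Suc i) = next_offset (w i) (v i) (x i)" "\<And>i. x i \<in> offsets"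
proof -
  define x where "x = rec_nat (0, 0, 0) (\<lambda>i. next_offset (w i) (v i))"
  have x: "x 0 = (0, 0, 0)" "\<And>i. x (Suc i) = next_offset (w i) (v i) (x i)" by (simp_all add: x_def)
  have "x n \<in> offsets \<and> place (x n) (val (\<lambda>i. w (n + i))) = val (\<lambda>i. v (n + i))" for n
  proof (induction n)
    case 0
    show ?case using assms lattice_zero by (simp add: x offsets_def)
  next
    case (Suc n)
    have step: "val (\<lambda>i. w (n + i)) = contr (w n) (val (\<lambda>i. w (Suc n + i)))" for w
      by (subst val_step) simp
    have "contr (v n) (place (x (Suc n)) (val (\<lambda>i. w (Suc n + i)))) = contr (v n) (val (\<lambda>i. v (Suc n + i)))"
      unfolding x contr_place_next using Suc step[of w] step[of v] by simp
    then have "place (x (Suc n)) (val (\<lambda>i. w (Suc n + i))) = val (\<lambda>i. v (Suc n + i))"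
      using dist_contr lam_powers by (metis dist_eq_0_iff less_irrefl mult_eq_0_iff)
    then show ?case using next_offset_in Suc norm_val unfolding x by blast
  qed
  then show ?thesis using that x by blast
qed

text \<open>
  A state consists of the offset, the previous guessed letter and a flag telling whether the last
  pair of guessed letters was not allowed. A word read by an accepting run has the same value as the
  guessed word because the offsets stay bounded.
\<close>

lemma recognizable_same_point:
  "buchi_recognizable digits {w \<in> digit_words. \<exists>v\<in>aper_coord_words. val w = val v}"
proof (rule buchi_recognizableI)
  let ?Q = "offsets \<times> digits \<times> (UNIV :: bool set)"
  \<comment> \<open>The initial previous letter is arbitrary: it only affects the flag after the first step.\<close>
  let ?I = "{(0, 0, 0)} \<times> {0::nat} \<times> {False}"
  let ?F = "offsets \<times> digits \<times> {True}"
  let ?E = "{(s, m, s'). s \<in> ?Q \<and> m \<in> digits \<and> s' \<in> ?Q \<and>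
      fst s' = next_offset m (fst (snd s')) (fst s) \<and>
      snd (snd s') = (\<not> leg_pair (fst (snd s)) (fst (snd s')))}"
  have 0: "(0, 0, 0) \<in> offsets" using lattice_zero by (simp add: offsets_def)
  show "finite ?Q" using finite_offsets finite_digits by simp
  show "?I \<subseteq> ?Q" using 0 by (auto simp: digits_def)
  show "finite digits" "?F \<subseteq> ?Q" "?E \<subseteq> ?Q \<times> digits \<times> ?Q" using finite_digits by auto
  fix w
  show "w \<in> {w \<in> digit_words. \<exists>v\<in>aper_coord_words. val w = val v} \<longleftrightarrow>
      (\<exists>r. r 0 \<in> ?I \<and> (\<forall>i. (r i, w i, r (Suc i)) \<in> ?E) \<and> (\<exists>\<^sub>\<infinity>i. r i \<in> ?F))"
  proof
    assume "w \<in> {w \<in> digit_words. \<exists>v\<in>aper_coord_words. val w = val v}"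
    then obtain v where w: "\<And>i. w i \<in> digits" and v: "\<And>i. v i \<in> digits"
        "\<exists>\<^sub>\<infinity>i. \<not> leg_pair (v i) (v (Suc i))" and eq: "val w = val v"
      by (auto simp: digit_words_def aper_coord_words_def)
    obtain x where x: "x 0 = (0, 0, 0)" "\<And>i. x (Suc i) = next_offset (w i) (v i) (x i)" "\<And>i. x i \<in> offsets"
      using offsets_of_val_eq[OF eq] by metis
    \<comment> \<open>The state after \<open>i\<close> steps holds the guessed letter with index \<open>i - 1\<close>.\<close>
    define l where "l = case_nat 0 v"
    have l: "l 0 = 0" "\<And>i. l (Suc i) = v i" by (simp_all add: l_def)
    have ld: "l i \<in> digits" for i using v(1) by (cases i) (auto simp: l digits_def)
    define f where "f = case_nat False (\<lambda>i. \<not> leg_pair (l i) (l (Suc i)))"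
    have f: "f 0 = False" "\<And>i. f (Suc i) = (\<not> leg_pair (l i) (l (Suc i)))" by (simp_all add: f_def)
    have inf: "\<exists>\<^sub>\<infinity>i. (x i, l i, f i) \<in> ?F"
    proof (unfold INFM_nat, rule allI)
      fix m
      obtain i where "i > m" "\<not> leg_pair (v i) (v (Suc i))" using v(2) by (auto simp: INFM_nat)
      then show "\<exists>n>m. (x n, l n, f n) \<in> ?F"
        using x(3) v(1) by (intro exI[of _ "Suc (Suc i)"]) (simp add: f l)
    qed
    have edge: "((x i, l i, f i), w i, (x (Suc i), l (Suc i), f (Suc i))) \<in> ?E" for i
      using x(3) ld w v(1) by (simp add: f(2) flip: x(2)) (simp add: l(2) x(2))
    show "\<exists>r. r 0 \<in> ?I \<and> (\<forall>i. (r i, w i, r (Suc i)) \<in> ?E) \<and> (\<exists>\<^sub>\<infinity>i. r i \<in> ?F)"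
      using inf edge by (intro exI[of _ "\<lambda>i. (x i, l i, f i)"] conjI allI) (simp_all only: x(1) l(1) f(1) mem_Times_iff fst_conv snd_conv singleton_iff)
  next
    assume "\<exists>r. r 0 \<in> ?I \<and> (\<forall>i. (r i, w i, r (Suc i)) \<in> ?E) \<and> (\<exists>\<^sub>\<infinity>i. r i \<in> ?F)"
    then obtain r where r: "r 0 \<in> ?I" "\<forall>i. (r i, w i, r (Suc i)) \<in> ?E" "\<exists>\<^sub>\<infinity>i. r i \<in> ?F"
      by (elim exE conjE) (rule that)
    define x l f where "x i = fst (r i)" and "l i = fst (snd (r i))" and "f i = snd (snd (r i))" for i
    have rE: "r i = (x i, l i, f i)" for i by (simp add: x_def l_def f_def)
    have E: "x i \<in> offsets" "l i \<in> digits" "w i \<in> digits" "x (Suc i) = next_offset (w i) (l (Suc i)) (x i)"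
        "f (Suc i) = (\<not> leg_pair (l i) (l (Suc i)))" for i
      using r(2)[rule_format, of i] by (simp_all add: rE)
    define v where "v i = l (Suc i)" for i
    have "val w = val v"
      by (rule val_eq_of_offsets[of x]) (use r(1) E in \<open>auto simp: rE v_def\<close>)
    moreover have "w \<in> digit_words" using E by (simp add: digit_words_def)
    moreover have "v \<in> aper_coord_words"
    proof -
      have "\<exists>n>m. \<not> leg_pair (v n) (v (Suc n))" for m
      proof -
        obtain i where "i > Suc (Suc m)" "f i" using r(3) by (auto simp: INFM_nat rE)
        then obtain j where "i = Suc (Suc j)" "j > m" by (metis Suc_lessE Suc_less_SucD)
        then show ?thesis using \<open>f i\<close> E(5)[of "Suc j"] by (auto simp: v_def)
      qed
      then show ?thesis using E(2) by (simp add: aper_coord_words_def digit_words_def v_def INFM_nat)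
    qed
    ultimately show "w \<in> {w \<in> digit_words. \<exists>v\<in>aper_coord_words. val w = val v}" by blast
  qed
qed

theorem mainTheorem1:
  shows "aperiodic_points \<inter> T_map ` Z_set \<subset> attractor
    \<and> attractor \<subseteq> closure (aperiodic_points \<inter> T_map ` Z_set)
    \<and> buchi_recognizable digits
        {w. \<exists>x \<in> aperiodic_points \<inter> T_map ` Z_set. is_address w x}"
proof -
  have "{w. \<exists>x \<in> pt ` aper_coord. is_address w x} = {w \<in> digit_words. \<exists>v\<in>aper_coord_words. val w = val v}"
    unfolding pt_aper_coord_val by (auto simp: is_address_val digit_words_def)
  then show ?thesis
    unfolding aperiodic_TZ using aper_coord_proper aper_coord_dense recognizable_same_point by simp
qed

end
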